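(* Let $n,k$ be positive integers with $k\le n$, let $\sigma>0$, let $\mu_1,\ldots,\mu_n\in[0,1]$ be arbitrary, and let $\mathcal{X}=\{x_1,\ldots,x_n\}\subseteq\mathbb{R}$, where $x_i=\mu_i+g_i$ with $g_1,\ldots,g_n$ independent one-dimensional Gaussian random variables with mean $0$ and standard deviation $\sigma$. Then (a) there is a polynomial $p$ (independent of $n,k,\sigma$ and the $\mu_i$) such that for every choice of initial centers the expected number of iterations of the $k$-means method on $\mathcal{X}$ is at most $p(n,1/\sigma)$; and (b) there are a polynomial $q$ and a constant $c>0$ (independent of $n,k,\sigma$ and the $\mu_i$) such that the probability that the number of iterations exceeds $q(n,1/\sigma)$ is at most $n^{-c}$.
   Context: The $k$-means method on a finite point set $\mathcal{X}\subseteq\mathbb{R}^d$ (here $d=1$) with $k$ clusters: (1) select initial cluster centers $c_1,\ldots,c_k$; (2) assign every $x\in\mathcal{X}$ to the cluster $C_i$ whose center $c_i$ is closest to $x$; (3) set $c_i=\frac{1}{|C_i|}\sum_{x\in C_i}x$ for every $i$; (4) if the clusters or the centers have changed, go to (2), otherwise terminate. An iteration is one execution of steps (2)–(3); the running time is the number of iterations. *)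

theory Defs
  imports "HOL-Probability.Probability"
begin

definition poly2 :: "(nat \<Rightarrow> nat \<Rightarrow> real) \<Rightarrow> nat \<Rightarrow> real \<Rightarrow> real \<Rightarrow> real" where
  "poly2 a D u v = (\<Sum>i\<le>D. \<Sum>j\<le>D. a i j * u ^ i * v ^ j)"

definition closest :: "nat \<Rightarrow> (nat \<Rightarrow> real) \<Rightarrow> real \<Rightarrow> nat" where
  "closest k c y = (LEAST i. i < k \<and> (\<forall>j<k. \<bar>y - c i\<bar> \<le> \<bar>y - c j\<bar>))"

definition cluster :: "nat \<Rightarrow> nat \<Rightarrow> (nat \<Rightarrow> real) \<Rightarrow> (nat \<Rightarrow> real) \<Rightarrow> nat \<Rightarrow> nat set" where
  "cluster n k x c i = {j. j < n \<and> closest k c (x j) = i}"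

definition kmeans_step :: "nat \<Rightarrow> nat \<Rightarrow> (nat \<Rightarrow> real) \<Rightarrow> (nat \<Rightarrow> real) \<Rightarrow> (nat \<Rightarrow> real)" where
  "kmeans_step n k x c = (\<lambda>i. if cluster n k x c i \<noteq> {}
       then (\<Sum>j\<in>cluster n k x c i. x j) / real (card (cluster n k x c i))
       else c i)"

definition centers :: "nat \<Rightarrow> nat \<Rightarrow> (nat \<Rightarrow> real) \<Rightarrow> (nat \<Rightarrow> real) \<Rightarrow> nat \<Rightarrow> (nat \<Rightarrow> real)" where
  "centers n k x c0 t = (kmeans_step n k x ^^ t) c0"

text \<open>The method terminates after iteration t (t \<ge> 1): iteration t uses the centers after t-1
  iterations to form the clusters and produces the centers after t iterations. It terminates iff
  neither the centers nor the clusters changed in iteration t (in iteration 1 there are no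
  previous clusters, so only the centers are compared).\<close>
definition kmeans_stops :: "nat \<Rightarrow> nat \<Rightarrow> (nat \<Rightarrow> real) \<Rightarrow> (nat \<Rightarrow> real) \<Rightarrow> nat \<Rightarrow> bool" where
  "kmeans_stops n k x c0 t \<longleftrightarrow> t \<ge> 1 \<and>
     centers n k x c0 t = centers n k x c0 (t - 1) \<and>
     (t \<ge> 2 \<longrightarrow> (\<forall>i. cluster n k x (centers n k x c0 (t - 1)) i
                     = cluster n k x (centers n k x c0 (t - 2)) i))"

definition kmeans_iters :: "nat \<Rightarrow> nat \<Rightarrow> (nat \<Rightarrow> real) \<Rightarrow> (nat \<Rightarrow> real) \<Rightarrow> enat" where
  "kmeans_iters n k x c0 =
     (if \<exists>t. kmeans_stops n k x c0 t then enat (LEAST t. kmeans_stops n k x c0 t) else \<infinity>)"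

definition perturbed :: "nat \<Rightarrow> (nat \<Rightarrow> real) \<Rightarrow> real \<Rightarrow> (nat \<Rightarrow> real) measure" where
  "perturbed n \<mu> \<sigma> = (\<Pi>\<^sub>M i\<in>{..<n}. density lborel (normal_density (\<mu> i) \<sigma>))"

end

theory Submission
  imports Defs
begin

text \<open>
  Every round decreases the cost of the current clustering, i.e. the sum of the squared distances to
  the cluster means. If the cost drops by less than \<open>\<eta>\<^sup>2\<close>, then all centers move by less than \<open>\<eta>\<close>;
  reading the line from left to right and assuming that no three points lie within distance
  \<open>12 n\<^sup>3 \<eta>\<close>, the only possible changes are that a cluster of two points is split into singletons or
  that a cluster is taken over by an unused center of smaller index at the same location. Both
  increase a weight which is at most \<open>2 n\<^sup>2\<close>, so the number of iterations is polynomial in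
  \<open>n\<close>, the diameter and \<open>1 / \<eta>\<close>, and quadratic in the last.

  Three Gaussian points are within distance \<open>L\<close> with probability \<open>O(n\<^sup>3 L\<^sup>2 / \<sigma>\<^sup>2)\<close>, so more than \<open>T\<close>
  iterations occur with probability \<open>O(poly / T)\<close>. Almost surely no clustering repeats, so
  there are at most about \<open>2 ^ n\<^sup>2\<close> iterations, and summing the tail over the powers of two up to this
  value gives a polynomial expectation. The tail bound follows from Markov's inequality.
\<close>

subsection \<open>Closest centers and means\<close>

definition mean :: "(nat \<Rightarrow> real) \<Rightarrow> nat set \<Rightarrow> real" where
  "mean x S = (\<Sum>j\<in>S. x j) / real (card S)"

definition fiber :: "nat \<Rightarrow> (nat \<Rightarrow> nat) \<Rightarrow> nat \<Rightarrow> nat set" where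
  "fiber n f i = {j. j < n \<and> f j = i}"

text \<open>Distances are taken to the cluster means rather than to the current centers, so the cost
  depends on the clustering alone and a recurring clustering has the same cost.\<close>

definition cost :: "nat \<Rightarrow> (nat \<Rightarrow> real) \<Rightarrow> (nat \<Rightarrow> nat) \<Rightarrow> real" where
  "cost n x f = (\<Sum>j<n. (x j - mean x (fiber n f (f j)))\<^sup>2)"

definition assignment :: "nat \<Rightarrow> (nat \<Rightarrow> real) \<Rightarrow> (nat \<Rightarrow> real) \<Rightarrow> nat \<Rightarrow> nat" where
  "assignment k x c j = closest k c (x j)"

text \<open>A smaller index weighs more, and two indices below \<open>k\<close> together outweigh any single one.\<close>

definition weight :: "nat \<Rightarrow> (nat \<Rightarrow> nat) \<Rightarrow> nat set \<Rightarrow> nat" where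
  "weight k f R = (\<Sum>i\<in>f ` R. 2 * k - i)"

text \<open>Distinctness is asked of the indices, so coinciding points count separately; for
  \<open>L = 0\<close> the condition says that no three points coincide.\<close>

definition no_close_triple :: "nat \<Rightarrow> (nat \<Rightarrow> real) \<Rightarrow> real \<Rightarrow> bool" where
  "no_close_triple n x L \<longleftrightarrow>
     (\<forall>i<n. \<forall>j<n. \<forall>l<n. i \<noteq> j \<and> i \<noteq> l \<and> j \<noteq> l \<longrightarrow> \<not> (\<bar>x j - x i\<bar> \<le> L \<and> \<bar>x l - x i\<bar> \<le> L))"

lemma closest_exists:
  fixes k :: nat and c :: "nat \<Rightarrow> real"
  assumes "1 \<le> k"
  shows "\<exists>i. i < k \<and> (\<forall>j<k. \<bar>y - c i\<bar> \<le> \<bar>y - c j\<bar>)"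
proof -
  have "finite {..<k}" "{..<k} \<noteq> {}" using assms by (auto simp: lessThan_empty_iff)
  from ex_min_if_finite[of "(\<lambda>i. \<bar>y - c i\<bar>) ` {..<k}"] this
  obtain i where "i < k" "\<not> (\<exists>j<k. \<bar>y - c j\<bar> < \<bar>y - c i\<bar>)" by auto
  thus ?thesis by (intro exI[of _ i]) auto
qed

lemma
  assumes "1 \<le> k"
  shows closest_less: "closest k c y < k"
    and closest_min: "j < k \<Longrightarrow> \<bar>y - c (closest k c y)\<bar> \<le> \<bar>y - c j\<bar>"
  using LeastI_ex[OF closest_exists[OF assms, of y c]] unfolding closest_def by auto

lemma closest_le:
  assumes "i < k" "\<And>j. j < k \<Longrightarrow> \<bar>y - c i\<bar> \<le> \<bar>y - c j\<bar>"
  shows "closest k c y \<le> i"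
  unfolding closest_def by (rule Least_le) (use assms in auto)

text \<open>The points at which one center is at least as close as another form a half-line or the
  whole line, so the center chosen at \<open>y\<close> and \<open>w\<close> is also nearest at
  \<open>z\<close>. The rest is tie-breaking: another choice \<open>b\<close> at \<open>z\<close>
  has a smaller index. If both centers coincide, \<open>b\<close> would have won at \<open>y\<close>
  too; otherwise the tie makes \<open>z\<close> the midpoint of the two centers, which forces
  \<open>y = z\<close> or \<open>w = z\<close>.\<close>

lemma closest_convex:
  assumes k: "1 \<le> k" and yz: "y \<le> z" and zw: "z \<le> w" and eq: "closest k c y = closest k c w"
  shows "closest k c z = closest k c y"
proof (rule ccontr)
  define a where "a = closest k c y"
  define b where "b = closest k c z"
  assume "closest k c z \<noteq> closest k c y"
  hence ab: "b \<noteq> a" by (simp add: a_def b_def)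
  have ak: "a < k" and bk: "b < k" using k by (auto simp: a_def b_def closest_less)
  have ya: "\<bar>y - c a\<bar> \<le> \<bar>y - c j\<bar>" if "j < k" for j
    using closest_min[OF k that, of y c] by (simp add: a_def)
  have wa: "\<bar>w - c a\<bar> \<le> \<bar>w - c j\<bar>" if "j < k" for j
    using closest_min[OF k that, of w c] eq by (simp add: a_def)
  have zb: "\<bar>z - c b\<bar> \<le> \<bar>z - c j\<bar>" if "j < k" for j
    using closest_min[OF k that, of z c] by (simp add: b_def)
  have za: "\<bar>z - c a\<bar> \<le> \<bar>z - c b\<bar>"
    using ya[OF bk] wa[OF bk] yz zw by (smt (verit))
  have "b \<le> a"
    unfolding b_def by (rule closest_le[OF ak]) (use za zb in force)
  have "c a \<noteq> c b"
  proof
    assume "c a = c b"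
    hence "\<bar>y - c b\<bar> \<le> \<bar>y - c j\<bar>" if "j < k" for j using ya[OF that] by simp
    hence "a \<le> b" unfolding a_def by (intro closest_le[OF bk])
    with \<open>b \<le> a\<close> ab show False by simp
  qed
  hence "y = z \<or> w = z"
    using ya[OF bk] wa[OF bk] yz zw za zb[OF ak] by (smt (verit))
  thus False using ab eq by (auto simp: a_def b_def)
qed

lemma sum_diff_mean:
  assumes "finite S"
  shows "(\<Sum>j\<in>S. x j - m) = real (card S) * (mean x S - m)"
  using assms by (cases "S = {}") (auto simp: mean_def sum_subtractf field_simps)

text \<open>The parallel axis identity: it measures the cost saved by moving a center from
  \<open>m\<close> to the mean.\<close>

lemma sum_sq_diff_mean:
  assumes "finite S"
  shows "(\<Sum>j\<in>S. (x j - m)\<^sup>2 - (x j - mean x S)\<^sup>2) = real (card S) * (m - mean x S)\<^sup>2"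
proof -
  have "(\<Sum>j\<in>S. (x j - m)\<^sup>2 - (x j - mean x S)\<^sup>2)
      = (\<Sum>j\<in>S. (mean x S - m) * (2 * (x j - mean x S) + (mean x S - m)))"
    by (intro sum.cong) (auto simp: power2_eq_square algebra_simps)
  also have "\<dots> = (mean x S - m) * (2 * (\<Sum>j\<in>S. x j - mean x S) + real (card S) * (mean x S - m))"
    unfolding sum_distrib_left[symmetric] sum.distrib by simp
  also have "\<dots> = real (card S) * (m - mean x S)\<^sup>2"
    unfolding sum_diff_mean[OF assms] by (simp add: power2_eq_square algebra_simps)
  finally show ?thesis .
qed

text \<open>All deviations from the lower bound \<open>p\<close> are nonnegative, so a single one is
  at most their sum, which is \<open>card S\<close> times the deviation of the mean. Hence a mean
  close to \<open>p\<close> forces every point of \<open>S\<close> close to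
  \<open>p\<close>.\<close>

lemma mean_lower:
  assumes "finite S" "s \<in> S" "\<And>j. j \<in> S \<Longrightarrow> p \<le> x j" "card S \<le> n"
  shows "x s - p \<le> real n * (mean x S - p)"
proof -
  have "x s - p \<le> (\<Sum>j\<in>S. x j - p)"
    using assms by (intro member_le_sum[where f = "\<lambda>j. x j - p"]) auto
  also have "\<dots> = real (card S) * (mean x S - p)" by (rule sum_diff_mean[OF assms(1)])
  finally have le: "x s - p \<le> real (card S) * (mean x S - p)" .
  have "card S > 0" using assms by (auto simp: card_gt_0_iff)
  hence "0 \<le> mean x S - p" using le assms(3)[OF assms(2)]
    by (smt (verit) zero_le_mult_iff of_nat_0_less_iff)
  hence "real (card S) * (mean x S - p) \<le> real n * (mean x S - p)"
    using assms(4) by (intro mult_right_mono) auto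
  with le show ?thesis by simp
qed

lemma mean_ge:
  assumes "finite S" "S \<noteq> {}" "\<And>j. j \<in> S \<Longrightarrow> p \<le> x j"
  shows "p \<le> mean x S"
proof -
  obtain s where s: "s \<in> S" using assms by auto
  have "x s - p \<le> real (card S) * (mean x S - p)"
    using mean_lower[OF assms(1) s assms(3) order_refl] .
  moreover have "card S > 0" using assms by (auto simp: card_gt_0_iff)
  ultimately show ?thesis using assms(3)[OF s]
    by (smt (verit) zero_le_mult_iff of_nat_0_less_iff)
qed

text \<open>For \<open>y\<close> in \<open>J - I\<close>, the deviation of \<open>x y\<close> from
  the mean of \<open>I\<close> is at most \<open>n\<close> times the gap of the means. Applying
  \<open>mean_lower\<close> to the reflected points of \<open>I\<close> bounds
  \<open>x y - x p\<close> by \<open>n\<close> times that deviation, which gives the factor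
  \<open>n ^ 2\<close>. A point \<open>z\<close> of \<open>I\<close> lies to the left of such a
  \<open>y\<close>.\<close>

lemma mean_gap:
  assumes "finite J" "I \<subset> J" "p \<in> I" "z \<in> J" "card J \<le> n"
    and ord: "\<And>i y. i \<in> I \<Longrightarrow> y \<in> J - I \<Longrightarrow> x i \<le> x y"
    and min: "\<And>i. i \<in> I \<Longrightarrow> x p \<le> x i"
  shows "x z - x p \<le> real n ^ 2 * (mean x J - mean x I)"
proof -
  have finI: "finite I" using assms finite_subset by blast
  have cI: "card I \<le> n" using assms card_mono[of J I] by auto
  define m where "m = mean x I"
  have main: "0 \<le> mean x J - m \<and> x y - x p \<le> real n ^ 2 * (mean x J - m)" if y: "y \<in> J - I" for y
  proof -
    have ge: "m \<le> x u" if "u \<in> J - I" for u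
    proof -
      have "- x u \<le> mean (\<lambda>i. - x i) I"
        using ord that assms finI by (intro mean_ge) auto
      thus ?thesis by (simp add: mean_def m_def sum_negf)
    qed
    have "x y - m \<le> (\<Sum>j\<in>J - I. x j - m)"
      using assms ge y by (intro member_le_sum[where f = "\<lambda>j. x j - m"]) auto
    also have "\<dots> = (\<Sum>j\<in>J. x j - m) - (\<Sum>j\<in>I. x j - m)"
      using assms by (intro sum_diff) auto
    also have "\<dots> = real (card J) * (mean x J - m)"
      using finI assms(1) by (simp add: sum_diff_mean m_def del: sum_subtractf)
    finally have 1: "x y - m \<le> real (card J) * (mean x J - m)" .
    have "card J > 0" using assms by (auto simp: card_gt_0_iff)
    hence 2: "0 \<le> mean x J - m" using 1 ge[OF y]
      by (smt (verit) zero_le_mult_iff of_nat_0_less_iff)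
    hence 3: "x y - m \<le> real n * (mean x J - m)"
      using 1 assms(5) mult_right_mono[of "real (card J)" "real n" "mean x J - m"] by simp
    have "- x p - - x y \<le> real n * (mean (\<lambda>i. - x i) I - - x y)"
      using finI assms(3) ord[OF _ y] cI by (intro mean_lower) auto
    hence "x y - x p \<le> real n * (x y - m)"
      by (simp add: mean_def m_def sum_negf)
    also have "\<dots> \<le> real n * (real n * (mean x J - m))" using 3 by (intro mult_left_mono) auto
    finally show ?thesis using 2 by (simp add: power2_eq_square mult.assoc)
  qed
  obtain y where y: "y \<in> J - I" using assms by auto
  show ?thesis
  proof (cases "z \<in> I")
    case True
    thus ?thesis using main[OF y] ord[OF True y] by (simp add: m_def)
  qed (use main[of z] assms in \<open>auto simp: m_def\<close>)
qed

text \<open>Here \<open>p\<close> is a point, \<open>a\<close> its old center and \<open>b\<close>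
  its new one. If both lie to the right of \<open>p\<close>, the difference of squares is at least
  \<open>(a - b)\<^sup>2\<close>, so \<open>a - b < \<eta>\<close>. Otherwise \<open>b\<close> is
  within \<eta> of \<open>p\<close>, and then \<open>a\<close> is within 2 \<eta> of
  \<open>p\<close>.\<close>

lemma near_equidistant:
  fixes p a b :: real
  assumes "\<bar>p - b\<bar> \<le> \<bar>p - a\<bar>" "p \<le> a" "p - \<eta> < b" "(p - a)\<^sup>2 - (p - b)\<^sup>2 < \<eta>\<^sup>2" "0 < \<eta>"
  shows "\<bar>a - b\<bar> < 3 * \<eta>"
proof (cases "p \<le> b")
  case True
  have "a - b < \<eta>"
  proof (rule ccontr)
    assume "\<not> a - b < \<eta>"
    hence "\<eta> * \<eta> \<le> (a - b) * ((a - p) + (b - p))" using assms True by (intro mult_mono) auto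
    thus False using assms by (simp add: power2_eq_square algebra_simps)
  qed
  thus ?thesis using assms True by auto
next
  case False
  have "(p - b)\<^sup>2 \<le> \<eta>\<^sup>2" using False assms by (intro power_mono) auto
  moreover have "0 < \<eta>\<^sup>2" using assms by simp
  ultimately have "(p - a)\<^sup>2 < 4 * \<eta>\<^sup>2" using assms(4) by linarith
  hence "(a - p)\<^sup>2 < (2 * \<eta>)\<^sup>2" by (simp add: power2_commute[of a p])
  hence "a - p < 2 * \<eta>" by (rule power2_less_imp_less) (use assms(5) in simp)
  thus ?thesis using False assms by auto
qed

subsection \<open>One round of the method\<close>

lemma finite_fiber [simp]: "finite (fiber n f i)"
  by (simp add: fiber_def)

lemma card_fiber_le: "card (fiber n f i) \<le> n"
  using card_mono[of "{..<n}" "fiber n f i"] by (auto simp: fiber_def)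

lemma assignment_convex:
  assumes "1 \<le> k" "x i \<le> x j" "x j \<le> x l" "assignment k x c i = assignment k x c l"
  shows "assignment k x c j = assignment k x c i"
  using closest_convex[OF assms(1-3)] assms(4) by (simp add: assignment_def)

text \<open>The centers \<open>e\<close> induce the clustering \<open>f\<close>, whose means are the
  centers \<open>c\<close>, which induce the next clustering \<open>g\<close>. The equation for
  \<open>c\<close> is restricted to labels in use, since an empty cluster keeps its old center. That
  \<open>f\<close> is itself induced by centers makes its clusters convex.\<close>

locale kmeans_round =
  fixes n k :: nat and x e c :: "nat \<Rightarrow> real" and f g :: "nat \<Rightarrow> nat"
  assumes k: "1 \<le> k"
    and f_eq: "f = assignment k x e"
    and g_eq: "g = assignment k x c"
    and center: "\<And>j. j < n \<Longrightarrow> c (f j) = mean x (fiber n f (f j))"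
begin

lemma f_less: "f j < k" and g_less: "g j < k"
  using k by (auto simp: f_eq g_eq assignment_def closest_less)

lemma g_min: "i < k \<Longrightarrow> \<bar>x j - c (g j)\<bar> \<le> \<bar>x j - c i\<bar>"
  using closest_min[OF k] by (simp add: g_eq assignment_def)

lemma g_le: "i < k \<Longrightarrow> (\<And>l. l < k \<Longrightarrow> \<bar>x j - c i\<bar> \<le> \<bar>x j - c l\<bar>) \<Longrightarrow> g j \<le> i"
  unfolding g_eq assignment_def by (rule closest_le)

lemma f_convex: "x i \<le> x j \<Longrightarrow> x j \<le> x l \<Longrightarrow> f i = f l \<Longrightarrow> f j = f i"
  using assignment_convex[OF k] by (simp add: f_eq)

lemma g_convex: "x i \<le> x j \<Longrightarrow> x j \<le> x l \<Longrightarrow> g i = g l \<Longrightarrow> g j = g i"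
  using assignment_convex[OF k] by (simp add: g_eq)

lemma cost_f: "cost n x f = (\<Sum>j<n. (x j - c (f j))\<^sup>2)"
  by (simp add: cost_def center)

text \<open>The drop of the cost consists of the gain from reassigning points to the centers
  \<open>c\<close> and the gain from moving these centers to the new means; the latter is evaluated
  by \<open>sum_sq_diff_mean\<close>. Both parts are sums of nonnegative terms.\<close>

lemma cost_split:
  "cost n x f - cost n x g =
     (\<Sum>j<n. (x j - c (f j))\<^sup>2 - (x j - c (g j))\<^sup>2)
   + (\<Sum>i\<in>g ` {..<n}. real (card (fiber n g i)) * (c i - mean x (fiber n g i))\<^sup>2)"
proof -
  have "(\<Sum>j<n. (x j - c (g j))\<^sup>2 - (x j - mean x (fiber n g (g j)))\<^sup>2)
      = (\<Sum>i\<in>g ` {..<n}. \<Sum>j\<in>{j\<in>{..<n}. g j = i}. (x j - c (g j))\<^sup>2 - (x j - mean x (fiber n g (g j)))\<^sup>2)"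
    by (rule sum.image_gen) simp
  also have "\<dots> = (\<Sum>i\<in>g ` {..<n}. \<Sum>j\<in>fiber n g i. (x j - c i)\<^sup>2 - (x j - mean x (fiber n g i))\<^sup>2)"
    by (intro sum.cong) (auto simp: fiber_def)
  also have "\<dots> = (\<Sum>i\<in>g ` {..<n}. real (card (fiber n g i)) * (c i - mean x (fiber n g i))\<^sup>2)"
    by (simp only: sum_sq_diff_mean finite_fiber)
  finally have "(\<Sum>j<n. (x j - c (g j))\<^sup>2 - (x j - mean x (fiber n g (g j)))\<^sup>2)
      = (\<Sum>i\<in>g ` {..<n}. real (card (fiber n g i)) * (c i - mean x (fiber n g i))\<^sup>2)" .
  thus ?thesis unfolding cost_f cost_def[of n x g] by (simp add: sum_subtractf)
qed

lemma reassign_nonneg: "0 \<le> (x j - c (f j))\<^sup>2 - (x j - c (g j))\<^sup>2"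
  using g_min[OF f_less, of j j] by (simp add: abs_le_square_iff)

lemma cost_decreases: "cost n x g \<le> cost n x f"
proof -
  have "0 \<le> (\<Sum>j<n. (x j - c (f j))\<^sup>2 - (x j - c (g j))\<^sup>2)"
    by (intro sum_nonneg reassign_nonneg)
  moreover have "0 \<le> (\<Sum>i\<in>g ` {..<n}. real (card (fiber n g i)) * (c i - mean x (fiber n g i))\<^sup>2)"
    by (intro sum_nonneg) auto
  ultimately show ?thesis using cost_split by linarith
qed

end

text \<open>The rounds in which the cost makes too little progress. The factor
  \<open>12 * real n ^ 3\<close> dominates all distances estimated in \<open>block\<close>, the
  largest of which is \<open>5 * real n ^ 3 * \<eta>\<close>.\<close>

locale small_drop_round = kmeans_round +
  fixes L \<eta> :: real
  assumes triple: "no_close_triple n x L"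
    and \<eta>: "0 < \<eta>" "12 * real n ^ 3 * \<eta> \<le> L"
    and drop: "cost n x f - cost n x g < \<eta>\<^sup>2"
begin

text \<open>A single nonnegative term of \<open>cost_split\<close> cannot exceed the total
  drop.\<close>

lemma reassign_small:
  assumes "j < n"
  shows "(x j - c (f j))\<^sup>2 - (x j - c (g j))\<^sup>2 < \<eta>\<^sup>2"
proof -
  have "(x j - c (f j))\<^sup>2 - (x j - c (g j))\<^sup>2 \<le> (\<Sum>j<n. (x j - c (f j))\<^sup>2 - (x j - c (g j))\<^sup>2)"
    using assms reassign_nonneg by (intro member_le_sum) auto
  moreover have "0 \<le> (\<Sum>i\<in>g ` {..<n}. real (card (fiber n g i)) * (c i - mean x (fiber n g i))\<^sup>2)"
    by (intro sum_nonneg) auto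
  ultimately show ?thesis using drop cost_split by linarith
qed

text \<open>Again one term of \<open>cost_split\<close>; its factor, the size of a cluster
  containing \<open>j\<close>, is at least one.\<close>

lemma move_small:
  assumes "j < n"
  shows "\<bar>c (g j) - mean x (fiber n g (g j))\<bar> < \<eta>"
proof -
  let ?m = "\<lambda>i. (c i - mean x (fiber n g i))\<^sup>2"
  have "j \<in> fiber n g (g j)" using assms by (simp add: fiber_def)
  hence "1 \<le> card (fiber n g (g j))" by (metis One_nat_def Suc_leI card_gt_0_iff empty_iff finite_fiber)
  hence "1 * ?m (g j) \<le> real (card (fiber n g (g j))) * ?m (g j)"
    by (intro mult_right_mono) auto
  also have "\<dots> \<le> (\<Sum>i\<in>g ` {..<n}. real (card (fiber n g i)) * ?m i)"
    using assms by (intro member_le_sum[where f = "\<lambda>i. real (card (fiber n g i)) * ?m i"]) auto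
  finally have "?m (g j) \<le> (\<Sum>i\<in>g ` {..<n}. real (card (fiber n g i)) * ?m i)" by simp
  moreover have "0 \<le> (\<Sum>j<n. (x j - c (f j))\<^sup>2 - (x j - c (g j))\<^sup>2)"
    by (intro sum_nonneg reassign_nonneg)
  ultimately have "?m (g j) < \<eta>\<^sup>2" using drop cost_split by linarith
  thus ?thesis using \<eta>(1) abs_le_square_iff[of \<eta> "c (g j) - mean x (fiber n g (g j))"] by linarith
qed

lemma no_triple:
  assumes "i < n" "j < n" "l < n" "i \<noteq> j" "i \<noteq> l" "j \<noteq> l"
    "\<bar>x j - x i\<bar> \<le> 12 * real n ^ 3 * \<eta>" "\<bar>x l - x i\<bar> \<le> 12 * real n ^ 3 * \<eta>"
  shows False
  using assms triple \<eta>(2) unfolding no_close_triple_def by (meson order_trans)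

text \<open>The clusters of the leftmost point p of R before and after the step are both initial
  segments of R with almost equal means, so they can only differ if together they consist of two
  points p, q; then the only possible change is that the cluster of p and q is split.\<close>

lemma block:
  assumes R: "R \<subseteq> {..<n}" "p \<in> R"
    and fR: "\<And>i. i \<in> R \<Longrightarrow> fiber n f (f i) \<subseteq> R" and gR: "\<And>i. i \<in> R \<Longrightarrow> fiber n g (g i) \<subseteq> R"
    and min: "\<And>i. i \<in> R \<Longrightarrow> x p \<le> x i"
  shows "\<exists>U. p \<in> U \<and> U \<subseteq> R \<and> (\<forall>i\<in>U. fiber n f (f i) \<subseteq> U) \<and> (\<forall>i\<in>U. fiber n g (g i) \<subseteq> U) \<and>
           ((\<forall>i\<in>U. f i = g i) \<or> weight k f U < weight k g U)"
proof -
  define a where "a = f p"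
  define b where "b = g p"
  define I where "I = fiber n f a"
  define J where "J = fiber n g b"
  have pn: "p < n" using R by auto
  hence n1: "1 \<le> real n" by simp
  have pow: "real n \<le> real n ^ 3" "real n ^ 2 \<le> real n ^ 3" "1 \<le> real n ^ 3"
    using n1 power_increasing[of 1 3 "real n"] power_increasing[of 2 3 "real n"]
      power_increasing[of 0 3 "real n"] by auto
  have pI: "p \<in> I" and pJ: "p \<in> J" using pn by (auto simp: I_def J_def fiber_def a_def b_def)
  have IR: "I \<subseteq> R" and JR: "J \<subseteq> R" using fR gR R(2) by (auto simp: I_def J_def a_def b_def)
  have [simp]: "finite I" "finite J" by (auto simp: I_def J_def)
  have cI: "card I \<le> n" and cJ: "card J \<le> n" by (auto simp: I_def J_def card_fiber_le)
  have I_down: "j \<in> I" if "i \<in> I" "j \<in> R" "x j \<le> x i" for i j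
    using f_convex[of p j i] min[OF that(2)] that R by (auto simp: I_def fiber_def a_def)
  have J_down: "j \<in> J" if "i \<in> J" "j \<in> R" "x j \<le> x i" for i j
    using g_convex[of p j i] min[OF that(2)] that R by (auto simp: J_def fiber_def b_def)
  have nested: "I \<subseteq> J \<or> J \<subseteq> I"
  proof (rule ccontr)
    assume "\<not> (I \<subseteq> J \<or> J \<subseteq> I)"
    then obtain i j where ij: "i \<in> I" "i \<notin> J" "j \<in> J" "j \<notin> I" by blast
    show False
    proof (cases "x i \<le> x j")
      case True
      thus ?thesis using J_down[of j i] ij IR by blast
    next
      case False
      thus ?thesis using I_down[of i j] ij JR by (meson linear subsetD)
    qed
  qed
  have ca: "c a = mean x I" using center[OF pn] by (simp add: a_def I_def)
  have cb: "\<bar>c b - mean x J\<bar> < \<eta>" using move_small[OF pn] by (simp add: b_def J_def)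
  have ab: "\<bar>x p - c b\<bar> \<le> \<bar>x p - c a\<bar>" using g_min[OF f_less] by (simp add: a_def b_def)
  have "x p \<le> mean x I" "x p \<le> mean x J"
    using pI pJ IR JR min by (auto intro!: mean_ge)
  \<comment> \<open>The old center \<open>c a\<close> is a mean of points to the right of
    \<open>p\<close>, and \<open>c b\<close> is within \<eta> of such a mean, so
    \<open>near_equidistant\<close> applies.\<close>
  hence cab: "\<bar>c a - c b\<bar> < 3 * \<eta>"
    using near_equidistant[OF ab] reassign_small[OF pn] cb ca \<eta>(1) by (simp add: a_def b_def)
  have means: "\<bar>mean x I - mean x J\<bar> < 4 * \<eta>" using cab cb ca by linarith
  \<comment> \<open>Of the two nested initial segments, the smaller lies to the left of the rest of
    the larger, so \<open>mean_gap\<close> turns the small gap between the means into a bound on the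
    extent of the larger one.\<close>
  have close: "\<bar>x z - x p\<bar> < 4 * real n ^ 2 * \<eta>" if "I \<noteq> J" "z \<in> I \<union> J" for z
  proof -
    have "x z - x p \<le> real n ^ 2 * \<bar>mean x J - mean x I\<bar>"
    proof (cases "I \<subseteq> J")
      case True
      have "x i \<le> x y" if "i \<in> I" "y \<in> J - I" for i y
        using I_down[OF that(1), of y] that JR by (meson DiffE linear subsetD)
      moreover have "I \<subset> J" "z \<in> J" using True that by auto
      ultimately have "x z - x p \<le> real n ^ 2 * (mean x J - mean x I)"
        using pI cJ IR min by (intro mean_gap) auto
      also have "\<dots> \<le> real n ^ 2 * \<bar>mean x J - mean x I\<bar>" by (intro mult_left_mono) auto
      finally show ?thesis .
    next
      case False
      have "x i \<le> x y" if "i \<in> J" "y \<in> I - J" for i y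
        using J_down[OF that(1), of y] that IR by (meson DiffE linear subsetD)
      moreover have "J \<subset> I" "z \<in> I" using False nested that by auto
      ultimately have "x z - x p \<le> real n ^ 2 * (mean x I - mean x J)"
        using pJ cI JR min by (intro mean_gap) auto
      also have "\<dots> \<le> real n ^ 2 * \<bar>mean x J - mean x I\<bar>" by (intro mult_left_mono) auto
      finally show ?thesis .
    qed
    also have "\<dots> < real n ^ 2 * (4 * \<eta>)" using means n1 by (intro mult_strict_left_mono) auto
    finally show ?thesis using min[of z] that IR JR by (auto simp: mult_ac)
  qed
  have two: "\<exists>q. q \<noteq> p \<and> I \<union> J = {p, q}" if IJ: "I \<noteq> J"
  proof -
    obtain q where q: "q \<in> I \<union> J" "q \<noteq> p" using IJ pI pJ by blast
    have "s = p \<or> s = q" if s: "s \<in> I \<union> J" for s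
    proof (rule ccontr)
      assume ne: "\<not> (s = p \<or> s = q)"
      have *: "4 * real n ^ 2 * \<eta> \<le> 12 * real n ^ 3 * \<eta>"
        using pow \<eta>(1) by (intro mult_right_mono) auto
      have "q < n" "s < n" using s q IR JR R by auto
      moreover have "\<bar>x q - x p\<bar> \<le> 12 * real n ^ 3 * \<eta>" "\<bar>x s - x p\<bar> \<le> 12 * real n ^ 3 * \<eta>"
        using close[OF IJ q(1)] close[OF IJ s] * by linarith+
      ultimately show False using no_triple[of p q s] ne q(2) pn by auto
    qed
    thus ?thesis using q pI by blast
  qed
  consider (same) "I = J" | (merge) "I \<noteq> J" "I \<subseteq> J" | (split) "I \<noteq> J" "J \<subseteq> I"
    using nested by blast
  thus ?thesis
  proof cases
    case same
    \<comment> \<open>No point of \<open>I\<close> is farther from \<open>c b\<close> than from the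
      mean \<open>c a\<close>, and the mean is the unique minimizer of the sum of squares, so the
      two centers coincide. Ties go to the smaller index, hence \<open>b \<le> a\<close>: at most
      the label changes, and then to a heavier one.\<close>
    have "(\<Sum>j\<in>I. (x j - c b)\<^sup>2 - (x j - mean x I)\<^sup>2) \<le> 0"
    proof (intro sum_nonpos)
      fix j assume "j \<in> I"
      hence "f j = a" "g j = b" using same by (auto simp: I_def J_def fiber_def)
      thus "(x j - c b)\<^sup>2 - (x j - mean x I)\<^sup>2 \<le> 0" using reassign_nonneg[of j] ca by simp
    qed
    hence "real (card I) * (c b - mean x I)\<^sup>2 \<le> 0" by (simp only: sum_sq_diff_mean \<open>finite I\<close>)
    moreover have "card I > 0" using pI by (auto simp: card_gt_0_iff)
    ultimately have cc: "c b = c a" using ca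
      by (smt (verit) mult_pos_pos of_nat_0_less_iff zero_less_power2)
    have "b \<le> a" unfolding b_def
      by (rule g_le) (use f_less g_min[of _ p] cc in \<open>auto simp: a_def b_def\<close>)
    have fI: "f i = a" if "i \<in> I" for i using that by (auto simp: I_def fiber_def)
    have gI: "g i = b" if "i \<in> I" for i using that unfolding same by (auto simp: J_def fiber_def)
    have img: "f ` I = {a}" "g ` I = {b}" using pI fI gI by auto
    have "(\<forall>i\<in>I. f i = g i) \<or> weight k f I < weight k g I"
    proof (cases "a = b")
      case True
      thus ?thesis using fI gI by simp
    next
      case False
      thus ?thesis using \<open>b \<le> a\<close> f_less[of p] unfolding weight_def img by (auto simp: a_def)
    qed
    moreover have "fiber n f (f i) \<subseteq> I" if "i \<in> I" for i using that by (auto simp: I_def fiber_def)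
    moreover have "fiber n g (g i) \<subseteq> I" if "i \<in> I" for i
      using that unfolding same by (auto simp: J_def fiber_def)
    ultimately show ?thesis using pI IR by (intro exI[of _ I]) auto
  next
    case merge
    \<comment> \<open>This case is contradictory. The singleton \<open>p\<close> sits on its center,
      so \<open>c b = x p\<close>. As \<open>q\<close> gains little by moving to \<open>c b\<close>,
      its old center \<open>c d\<close> is near \<open>q\<close>. A further point in the old cluster
      \<open>K\<close> of \<open>q\<close> would then give a close triple, so \<open>K = {q}\<close>
      and \<open>c d = x q\<close>. Hence \<open>q\<close> moves only to a center at
      \<open>x q\<close>, while \<open>c b = x p < x q\<close>.\<close>
    then obtain q where q: "q \<noteq> p" "I \<union> J = {p, q}" using two by blast
    hence J: "J = {p, q}" using merge by blast
    hence I: "I = {p}" using merge pI by blast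
    have qn: "q < n" using J JR R by auto
    define d where "d = f q"
    have da: "d \<noteq> a" using I qn q(1) by (auto simp: I_def fiber_def d_def)
    have pa: "c a = x p" unfolding ca I by (simp add: mean_def)
    hence pb: "c b = x p" using ab by simp
    have gq: "g q = b" using J by (auto simp: J_def fiber_def)
    have xpq: "x p < x q"
      using I_down[of p q] J JR I q(1) by force
    define K where "K = fiber n f d"
    have qK: "q \<in> K" using qn by (simp add: K_def fiber_def d_def)
    have KR: "K \<subseteq> R" using fR[of q] J JR by (auto simp: K_def d_def)
    have KI: "K \<inter> I = {}" using da by (auto simp: K_def I_def fiber_def)
    have Kq: "x q \<le> x s" if "s \<in> K" for s
    proof (rule ccontr)
      assume "\<not> x q \<le> x s"
      hence "s \<in> J" using J_down[of q s] J that KR by auto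
      thus False using J KI I that \<open>\<not> x q \<le> x s\<close> by auto
    qed
    have cd: "c d = mean x K" using center[OF qn] by (simp add: d_def K_def)
    have "\<bar>x q - c d\<bar> \<le> \<bar>x q - x p\<bar> + \<eta>"
    proof -
      have "(x q - c d)\<^sup>2 < (x q - x p)\<^sup>2 + \<eta>\<^sup>2"
        using reassign_small[OF qn] gq pb by (simp add: d_def)
      also have "\<dots> \<le> (\<bar>x q - x p\<bar> + \<eta>)\<^sup>2" using \<eta>(1) by (simp add: power2_sum)
      finally show ?thesis using \<eta>(1)
        by (metis abs_ge_zero add_nonneg_nonneg less_imp_le power2_abs power2_le_imp_le)
    qed
    hence cdq: "c d - x q \<le> 4 * real n ^ 2 * \<eta> + \<eta>" using close[of q] merge J by auto
    have "K = {q}"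
    proof (rule ccontr)
      assume "K \<noteq> {q}"
      then obtain s where s: "s \<in> K" "s \<noteq> q" using qK by blast
      have "x s - x q \<le> real n * (mean x K - x q)"
        using s Kq by (intro mean_lower) (auto simp: K_def card_fiber_le)
      also have "\<dots> \<le> real n * (4 * real n ^ 2 * \<eta> + \<eta>)"
        using cdq cd by (intro mult_left_mono) auto
      also have "\<dots> = 4 * real n ^ 3 * \<eta> + real n * \<eta>"
        by (simp add: power2_eq_square power3_eq_cube algebra_simps)
      also have "\<dots> \<le> 4 * real n ^ 3 * \<eta> + real n ^ 3 * \<eta>"
        using pow \<eta>(1) by (intro add_left_mono mult_right_mono) auto
      finally have 1: "\<bar>x s - x q\<bar> \<le> 5 * real n ^ 3 * \<eta>" using Kq[OF s(1)] by (simp add: algebra_simps)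
      have "\<bar>x p - x q\<bar> \<le> 4 * real n ^ 2 * \<eta>" using close[of q] merge J by auto
      also have "\<dots> \<le> 4 * real n ^ 3 * \<eta>" using pow \<eta>(1) by (intro mult_right_mono mult_left_mono) auto
      finally have 2: "\<bar>x p - x q\<bar> \<le> 4 * real n ^ 3 * \<eta>" .
      have 3: "0 \<le> real n ^ 3 * \<eta>" using \<eta>(1) by simp
      show False
        by (rule no_triple[of q p s]) (use 1 2 3 qn pn s KR R q(1) KI pI in \<open>auto\<close>)
    qed
    hence "c d = x q" unfolding cd by (simp add: mean_def)
    hence "c b = x q" using g_min[OF f_less, of q q] gq by (simp add: d_def)
    thus ?thesis using pb xpq by simp
  next
    case split
    \<comment> \<open>The old center is the midpoint of \<open>p\<close> and \<open>q\<close>, so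
      the new center of \<open>q\<close> is near \<open>q\<close>, and by \<open>move_small\<close>
      so is the mean of its new cluster \<open>K\<close>. A further point in \<open>K\<close> would
      give a close triple. Thus \<open>K = {q}\<close>, the pair is closed under both clusterings,
      and one label is replaced by two.\<close>
    then obtain q where q: "q \<noteq> p" "I \<union> J = {p, q}" using two by blast
    hence I: "I = {p, q}" using split by blast
    hence J: "J = {p}" using split pJ by blast
    have qn: "q < n" using I IR R by auto
    define d where "d = g q"
    have db: "d \<noteq> b" using J qn q(1) by (auto simp: J_def fiber_def d_def)
    define K where "K = fiber n g d"
    have qK: "q \<in> K" using qn by (simp add: K_def fiber_def d_def)
    have KR: "K \<subseteq> R" using gR[of q] I IR by (auto simp: K_def d_def)
    have KJ: "K \<inter> J = {}" using db by (auto simp: K_def J_def fiber_def)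
    have Kq: "x q \<le> x s" if "s \<in> K" for s
    proof (rule ccontr)
      assume "\<not> x q \<le> x s"
      hence "s \<in> I" using I_down[of q s] I that KR by auto
      thus False using I KJ J that \<open>\<not> x q \<le> x s\<close> by auto
    qed
    have pq: "\<bar>x p - x q\<bar> \<le> 4 * real n ^ 2 * \<eta>" using close[of q] split I by auto
    have fq: "f q = a" using I by (auto simp: I_def fiber_def)
    have caI: "c a = (x p + x q) / 2" unfolding ca I using q(1) by (simp add: mean_def)
    have "\<bar>x q - c d\<bar> \<le> \<bar>x q - c a\<bar>" using g_min[OF f_less, of q p] by (simp add: a_def d_def)
    also have "\<dots> \<le> \<bar>x p - x q\<bar>" unfolding caI by (auto simp: abs_if field_simps)
    finally have mK: "mean x K - x q \<le> 4 * real n ^ 2 * \<eta> + \<eta>"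
      using move_small[OF qn] pq unfolding d_def[symmetric] K_def[symmetric] by linarith
    have K: "K = {q}"
    proof (rule ccontr)
      assume "K \<noteq> {q}"
      then obtain s where s: "s \<in> K" "s \<noteq> q" using qK by blast
      have "x s - x q \<le> real n * (mean x K - x q)"
        using s Kq by (intro mean_lower) (auto simp: K_def card_fiber_le)
      also have "\<dots> \<le> real n * (4 * real n ^ 2 * \<eta> + \<eta>)"
        using mK by (intro mult_left_mono) auto
      also have "\<dots> = 4 * real n ^ 3 * \<eta> + real n * \<eta>"
        by (simp add: power2_eq_square power3_eq_cube algebra_simps)
      also have "\<dots> \<le> 4 * real n ^ 3 * \<eta> + real n ^ 3 * \<eta>"
        using pow \<eta>(1) by (intro add_left_mono mult_right_mono) auto
      finally have 1: "\<bar>x s - x q\<bar> \<le> 5 * real n ^ 3 * \<eta>" using Kq[OF s(1)] by (simp add: algebra_simps)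
      have "4 * real n ^ 2 * \<eta> \<le> 4 * real n ^ 3 * \<eta>" using pow \<eta>(1) by (intro mult_right_mono mult_left_mono) auto
      hence 2: "\<bar>x p - x q\<bar> \<le> 4 * real n ^ 3 * \<eta>" using pq by linarith
      have 3: "0 \<le> real n ^ 3 * \<eta>" using \<eta>(1) by simp
      show False
        by (rule no_triple[of q p s]) (use 1 2 3 qn pn s KR R q(1) KJ pJ in \<open>auto\<close>)
    qed
    have img: "f ` I = {a}" "g ` I = {b, d}" using I fq by (auto simp: a_def b_def d_def)
    have "weight k f I < weight k g I"
      unfolding weight_def img using db f_less[of p] g_less[of p] g_less[of q]
      by (auto simp: a_def b_def d_def)
    moreover have "fiber n f (f i) \<subseteq> I" if "i \<in> I" for i using that by (auto simp: I_def fiber_def)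
    moreover have "fiber n g (g i) \<subseteq> I" if "i \<in> I" for i
      using that K J unfolding I K_def J_def b_def d_def by auto
    ultimately show ?thesis using pI IR by (intro exI[of _ I]) auto
  qed
qed

text \<open>A label used in \<open>U\<close> cannot occur in \<open>R - U\<close>, because
  \<open>U\<close> contains the whole cluster of each of its points.\<close>

lemma weight_split:
  assumes "finite R" "U \<subseteq> R" "R \<subseteq> {..<n}" "\<And>i. i \<in> U \<Longrightarrow> fiber n h (h i) \<subseteq> U"
  shows "weight k h R = weight k h U + weight k h (R - U)"
proof -
  have "h ` R = h ` U \<union> h ` (R - U)" using assms(2) by auto
  moreover have "h ` U \<inter> h ` (R - U) = {}" 
  proof (rule ccontr)
    assume "h ` U \<inter> h ` (R - U) \<noteq> {}"
    then obtain u v where "u \<in> U" "v \<in> R - U" "h u = h v" by auto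
    thus False using assms(3) assms(4)[of u] by (auto simp: fiber_def)
  qed
  ultimately show ?thesis
    using assms(1,2) finite_subset[of U R] by (simp add: weight_def sum.union_disjoint)
qed

text \<open>Induction from left to right: \<open>block\<close> cuts off a set \<open>U\<close>
  containing the leftmost point, the remainder is again a union of clusters of both clusterings, and
  the weights add up by \<open>weight_split\<close>.\<close>

lemma weight_mono_closed:
  assumes "R \<subseteq> {..<n}" "\<And>i. i \<in> R \<Longrightarrow> fiber n f (f i) \<subseteq> R" "\<And>i. i \<in> R \<Longrightarrow> fiber n g (g i) \<subseteq> R"
  shows "weight k f R \<le> weight k g R \<and> ((\<exists>j\<in>R. f j \<noteq> g j) \<longrightarrow> weight k f R < weight k g R)"
  using assms
proof (induction "card R" arbitrary: R rule: less_induct)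
  case less
  have finR: "finite R" using less.prems(1) finite_subset by blast
  show ?case
  proof (cases "R = {}")
    case False
    define p where "p = arg_min_on x R"
    have p: "p \<in> R" "\<And>i. i \<in> R \<Longrightarrow> x p \<le> x i"
      using arg_min_if_finite(1)[OF finR False, of x] arg_min_least[OF finR False, of _ x]
      by (auto simp: p_def)
    have "\<exists>U. p \<in> U \<and> U \<subseteq> R \<and> (\<forall>i\<in>U. fiber n f (f i) \<subseteq> U) \<and> (\<forall>i\<in>U. fiber n g (g i) \<subseteq> U) \<and>
        ((\<forall>i\<in>U. f i = g i) \<or> weight k f U < weight k g U)"
      by (rule block) (fact less.prems(1) p(1) less.prems(2,3) p(2))+
    then obtain U where U: "p \<in> U" "U \<subseteq> R" "\<forall>i\<in>U. fiber n f (f i) \<subseteq> U"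
      "\<forall>i\<in>U. fiber n g (g i) \<subseteq> U" "(\<forall>i\<in>U. f i = g i) \<or> weight k f U < weight k g U"
      by (elim exE conjE)
    have "card (R - U) < card R" using U(1) p(1) finR by (intro psubset_card_mono) auto
    moreover have "R - U \<subseteq> {..<n}" using less.prems(1) by auto
    moreover have "fiber n f (f i) \<subseteq> R - U" if "i \<in> R - U" for i
    proof
      fix l assume l: "l \<in> fiber n f (f i)"
      hence "l \<in> R" using less.prems(2)[of i] that by auto
      moreover have "i \<in> fiber n f (f l)" using l that less.prems(1) by (auto simp: fiber_def)
      ultimately show "l \<in> R - U" using bspec[OF U(3), of l] that by auto
    qed
    moreover have "fiber n g (g i) \<subseteq> R - U" if "i \<in> R - U" for i
    proof
      fix l assume l: "l \<in> fiber n g (g i)"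
      hence "l \<in> R" using less.prems(3)[of i] that by auto
      moreover have "i \<in> fiber n g (g l)" using l that less.prems(1) by (auto simp: fiber_def)
      ultimately show "l \<in> R - U" using bspec[OF U(4), of l] that by auto
    qed
    ultimately have IH: "weight k f (R - U) \<le> weight k g (R - U)"
      "(\<exists>j\<in>R - U. f j \<noteq> g j) \<longrightarrow> weight k f (R - U) < weight k g (R - U)"
      using less.hyps[of "R - U"] by blast+
    have wf: "weight k f R = weight k f U + weight k f (R - U)"
      by (rule weight_split[OF finR U(2) less.prems(1) bspec[OF U(3)]])
    have wg: "weight k g R = weight k g U + weight k g (R - U)"
      by (rule weight_split[OF finR U(2) less.prems(1) bspec[OF U(4)]])
    from U(5) show ?thesis
    proof
      assume eq: "\<forall>i\<in>U. f i = g i"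
      hence "weight k f U = weight k g U" by (simp add: weight_def)
      thus ?thesis using IH wf wg eq by auto
    qed (use IH wf wg in auto)
  qed (simp add: weight_def)
qed

lemma weight_increases:
  assumes "j < n" "f j \<noteq> g j"
  shows "weight k f {..<n} < weight k g {..<n}"
  using weight_mono_closed[of "{..<n}"] assms by (auto simp: fiber_def)

end

subsection \<open>Deterministic bounds on the number of iterations\<close>

text \<open>Indices start at zero: this is the clustering formed in iteration
  \<open>t + 1\<close>.\<close>

definition assign_at :: "nat \<Rightarrow> nat \<Rightarrow> (nat \<Rightarrow> real) \<Rightarrow> (nat \<Rightarrow> real) \<Rightarrow> nat \<Rightarrow> nat \<Rightarrow> nat" where
  "assign_at n k x c0 t = assignment k x (centers n k x c0 t)"

text \<open>The scaling turns a cost drop of \<open>\<eta>\<^sup>2\<close> into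
  \<open>2 * real n ^ 2 + 1\<close>, one more than the weight can ever lose. So a round with a large
  drop lowers the potential by at least one, and so does a round with a small drop, where the weight
  grows and the cost does not.\<close>

definition potential :: "nat \<Rightarrow> nat \<Rightarrow> (nat \<Rightarrow> real) \<Rightarrow> real \<Rightarrow> (nat \<Rightarrow> nat) \<Rightarrow> real" where
  "potential n k x \<eta> f = cost n x f * ((2 * real n ^ 2 + 1) / \<eta>\<^sup>2) - real (weight k f {..<n})"

lemma cluster_eq_fiber: "cluster n k x c i = fiber n (assignment k x c) i"
  by (simp add: cluster_def fiber_def assignment_def)

lemma centers_Suc: "centers n k x c0 (Suc t) = kmeans_step n k x (centers n k x c0 t)"
  by (simp add: centers_def)

lemma kmeans_step_center:
  assumes "j < n"
  shows "kmeans_step n k x c (assignment k x c j) = mean x (fiber n (assignment k x c) (assignment k x c j))"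
  using assms by (auto simp: kmeans_step_def cluster_eq_fiber mean_def fiber_def)

lemma kmeans_round_assign_at:
  assumes "1 \<le> k"
  shows "kmeans_round n k x (centers n k x c0 t) (centers n k x c0 (Suc t))
           (assign_at n k x c0 t) (assign_at n k x c0 (Suc t))"
  by unfold_locales (use assms in \<open>simp_all add: assign_at_def centers_Suc kmeans_step_center\<close>)

lemma fiber_cong: "(\<And>j. j < n \<Longrightarrow> f j = g j) \<Longrightarrow> fiber n f i = fiber n g i"
  by (auto simp: fiber_def)

text \<open>Equal clusters have equal means, and empty clusters keep their centers. Iterations
  \<open>t + 1\<close> and \<open>t + 2\<close> form the two clusterings in question, so it is
  iteration \<open>t + 2\<close> that detects the standstill.\<close>

lemma kmeans_stops_if_same_assignment:
  assumes "\<And>j. j < n \<Longrightarrow> assign_at n k x c0 (Suc t) j = assign_at n k x c0 t j"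
  shows "kmeans_stops n k x c0 (Suc (Suc t))"
proof -
  have cl: "cluster n k x (centers n k x c0 (Suc t)) i = cluster n k x (centers n k x c0 t) i" for i
    unfolding cluster_eq_fiber using assms by (intro fiber_cong) (simp add: assign_at_def)
  have "centers n k x c0 (Suc (Suc t)) = centers n k x c0 (Suc t)"
  proof
    fix i
    show "centers n k x c0 (Suc (Suc t)) i = centers n k x c0 (Suc t) i"
      using cl[of i] by (simp add: centers_Suc[of _ _ _ _ "Suc t"] kmeans_step_def)
        (simp add: centers_Suc kmeans_step_def)
  qed
  thus ?thesis using cl by (simp add: kmeans_stops_def)
qed

lemma kmeans_iters_gt_iff:
  "enat T < kmeans_iters n k x c0 \<longleftrightarrow> (\<forall>s\<le>T. \<not> kmeans_stops n k x c0 s)"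
proof (cases "\<exists>t. kmeans_stops n k x c0 t")
  case True
  define m where "m = (LEAST t. kmeans_stops n k x c0 t)"
  have m: "kmeans_stops n k x c0 m" using True unfolding m_def by (auto intro: LeastI)
  have "kmeans_iters n k x c0 = enat m" using True by (simp add: kmeans_iters_def m_def)
  moreover have "\<not> kmeans_stops n k x c0 s" if "s < m" for s
    using that not_less_Least[of s "kmeans_stops n k x c0"] unfolding m_def by blast
  ultimately show ?thesis using m by (auto simp: not_less) (meson le_less_trans not_le)
qed (auto simp: kmeans_iters_def)

lemma weight_le:
  assumes "k \<le> n"
  shows "real (weight k f {..<n}) \<le> 2 * real n ^ 2"
proof -
  have "weight k f {..<n} \<le> (\<Sum>i\<in>f ` {..<n}. 2 * n)"
    unfolding weight_def using assms by (intro sum_mono) auto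
  also have "\<dots> = card (f ` {..<n}) * (2 * n)" by simp
  also have "\<dots> \<le> n * (2 * n)" using card_image_le[of "{..<n}" f] by (intro mult_right_mono) auto
  finally have "real (weight k f {..<n}) \<le> real (n * (2 * n))" by (rule of_nat_mono)
  thus ?thesis by (simp add: power2_eq_square)
qed

lemma cost_nonneg: "0 \<le> cost n x f"
  by (simp add: cost_def sum_nonneg)

lemma cost_le_diameter:
  assumes "\<And>i j. i < n \<Longrightarrow> j < n \<Longrightarrow> \<bar>x i - x j\<bar> \<le> D"
  shows "cost n x f \<le> real n * D\<^sup>2"
proof -
  have "(x j - mean x (fiber n f (f j)))\<^sup>2 \<le> D\<^sup>2" if j: "j < n" for j
  proof -
    have ne: "fiber n f (f j) \<noteq> {}" using j by (auto simp: fiber_def)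
    have "x j - D \<le> mean x (fiber n f (f j))"
      using ne assms[OF j] by (intro mean_ge) (force simp: fiber_def)+
    moreover have "- (x j + D) \<le> mean (\<lambda>i. - x i) (fiber n f (f j))"
      using ne assms[OF j] by (intro mean_ge) (force simp: fiber_def)+
    moreover have "mean (\<lambda>i. - x i) (fiber n f (f j)) = - mean x (fiber n f (f j))"
      by (simp add: mean_def sum_negf)
    ultimately have "\<bar>x j - mean x (fiber n f (f j))\<bar> \<le> D" by linarith
    thus ?thesis by (rule abs_le_square_iff[THEN iffD1, OF order_trans]) simp
  qed
  hence "cost n x f \<le> (\<Sum>j<n. D\<^sup>2)" unfolding cost_def by (intro sum_mono) simp
  thus ?thesis by simp
qed

lemma potential_step:
  assumes kn: "1 \<le> k" "k \<le> n" and \<eta>: "0 < \<eta>" "no_close_triple n x (12 * real n ^ 3 * \<eta>)"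
    and ne: "j < n" "assign_at n k x c0 (Suc t) j \<noteq> assign_at n k x c0 t j"
  shows "potential n k x \<eta> (assign_at n k x c0 (Suc t)) \<le> potential n k x \<eta> (assign_at n k x c0 t) - 1"
proof -
  let ?f = "assign_at n k x c0 t" and ?g = "assign_at n k x c0 (Suc t)"
  let ?F = "(2 * real n ^ 2 + 1) / \<eta>\<^sup>2"
  interpret kmeans_round n k x "centers n k x c0 t" "centers n k x c0 (Suc t)" ?f ?g
    by (rule kmeans_round_assign_at[OF kn(1)])
  have F: "0 \<le> ?F" by simp
  show ?thesis
  proof (cases "cost n x ?f - cost n x ?g < \<eta>\<^sup>2")
    case True
    interpret small_drop_round n k x "centers n k x c0 t" "centers n k x c0 (Suc t)" ?f ?g
      "12 * real n ^ 3 * \<eta>" \<eta>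
      by unfold_locales (use True \<eta> in auto)
    have "weight k ?f {..<n} < weight k ?g {..<n}" using weight_increases[OF ne(1)] ne(2) by simp
    moreover have "cost n x ?g * ?F \<le> cost n x ?f * ?F"
      using cost_decreases F by (rule mult_right_mono)
    ultimately show ?thesis unfolding potential_def by linarith
  next
    case False
    have "\<eta>\<^sup>2 * ?F \<le> (cost n x ?f - cost n x ?g) * ?F" using False F by (intro mult_right_mono) auto
    moreover have "\<eta>\<^sup>2 * ?F = 2 * real n ^ 2 + 1" using \<eta>(1) by simp
    moreover have "real (weight k ?f {..<n}) \<le> 2 * real n ^ 2" by (rule weight_le[OF kn(2)])
    ultimately show ?thesis unfolding potential_def left_diff_distrib by linarith
  qed
qed

context
  fixes n k T :: nat and x c0 :: "nat \<Rightarrow> real" and L :: real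
  assumes k: "1 \<le> k" "k \<le> n" and L: "0 < L" "no_close_triple n x L"
    and long: "enat T < kmeans_iters n k x c0"
begin

text \<open>Chosen such that \<open>12 * real n ^ 3 * \<eta> = L\<close>, as
  \<open>potential_step\<close> requires.\<close>

private definition "\<eta> = L / (12 * real n ^ 3)"
private definition "V t = potential n k x \<eta> (assign_at n k x c0 t)"

text \<open>An unchanged clustering would end the run by iteration \<open>t + 2\<close>, which is at
  most \<open>T\<close>.\<close>

private lemma V_Suc: "Suc (Suc t) \<le> T \<Longrightarrow> V (Suc t) \<le> V t - 1"
proof -
  assume t: "Suc (Suc t) \<le> T"
  have n: "real n > 0" using k by simp
  hence \<eta>: "0 < \<eta>" "12 * real n ^ 3 * \<eta> = L" using L by (auto simp: \<eta>_def)
  have "\<not> kmeans_stops n k x c0 (Suc (Suc t))" using long t by (auto simp: kmeans_iters_gt_iff)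
  then obtain j where "j < n" "assign_at n k x c0 (Suc t) j \<noteq> assign_at n k x c0 t j"
    using kmeans_stops_if_same_assignment by blast
  thus ?thesis unfolding V_def using potential_step[OF k \<eta>(1)] \<eta>(2) L(2) by simp
qed

private lemma V_diff: "s \<le> t \<Longrightarrow> Suc t \<le> T \<Longrightarrow> V t \<le> V s - real (t - s)"
proof (induction t rule: dec_induct)
  case (step t)
  thus ?case using V_Suc[of t] by (simp add: Suc_diff_le)
qed simp

text \<open>In \<open>T - 1\<close> steps \<open>V\<close> falls by at least one each, from at most
  the scaled maximal cost to at least \<open>- (2 * real n ^ 2)\<close>. Inserting \<eta> gives the
  constant 432 = 3 * 144 and the exponent 9 = 1 + 2 + 6; the term \<open>3 * real n ^ 2\<close> also
  absorbs the missing step.\<close>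

lemma kmeans_iters_poly_bound:
  assumes "\<And>i j. i < n \<Longrightarrow> j < n \<Longrightarrow> \<bar>x i - x j\<bar> \<le> D"
  shows "real T \<le> 3 * real n ^ 2 + 432 * real n ^ 9 * D\<^sup>2 / L\<^sup>2"
proof (cases "T = 0")
  case False
  have n: "1 \<le> real n" using k by simp
  have "V (T - 1) \<le> V 0 - real (T - 1)" using V_diff[of 0 "T - 1"] False by simp
  moreover have "- (2 * real n ^ 2) \<le> V (T - 1)"
  proof -
    have "0 \<le> cost n x (assign_at n k x c0 (T - 1)) * ((2 * real n ^ 2 + 1) / \<eta>\<^sup>2)"
      by (intro mult_nonneg_nonneg cost_nonneg) auto
    thus ?thesis using weight_le[OF k(2), of "assign_at n k x c0 (T - 1)"]
      unfolding V_def potential_def by linarith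
  qed
  moreover have "V 0 \<le> real n * D\<^sup>2 * ((2 * real n ^ 2 + 1) / \<eta>\<^sup>2)"
  proof -
    have "cost n x (assign_at n k x c0 0) * ((2 * real n ^ 2 + 1) / \<eta>\<^sup>2)
       \<le> real n * D\<^sup>2 * ((2 * real n ^ 2 + 1) / \<eta>\<^sup>2)"
      using cost_le_diameter[OF assms] by (intro mult_right_mono) auto
    thus ?thesis unfolding V_def potential_def by linarith
  qed
  moreover have "real n * D\<^sup>2 * ((2 * real n ^ 2 + 1) / \<eta>\<^sup>2) \<le> real n * D\<^sup>2 * ((3 * real n ^ 2) / \<eta>\<^sup>2)"
    using n by (intro mult_left_mono divide_right_mono) auto
  moreover have "real n * D\<^sup>2 * ((3 * real n ^ 2) / \<eta>\<^sup>2) = 432 * real n ^ 9 * D\<^sup>2 / L\<^sup>2"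
  proof -
    have "real n * D\<^sup>2 * ((3 * real n ^ 2) / \<eta>\<^sup>2)
        = 3 * D\<^sup>2 * (real n * real n ^ 2 * (12 * real n ^ 3)\<^sup>2) / L\<^sup>2"
      by (simp add: \<eta>_def power_divide)
    also have "real n * real n ^ 2 * (12 * real n ^ 3)\<^sup>2 = 144 * real n ^ 9"
      by (simp add: power_mult_distrib power_mult[symmetric] power_add[symmetric] flip: power_Suc)
    finally show ?thesis by simp
  qed
  moreover have "1 \<le> real n ^ 2" using n by simp
  ultimately show ?thesis using False by simp
qed simp

text \<open>Since \<open>V\<close> strictly decreases and depends only on the labels of the
  \<open>n\<close> points, the first \<open>T\<close> clusterings are pairwise different, and there
  are only \<open>k ^ n\<close> of them. The bound is independent of \<open>L\<close>.\<close>

lemma kmeans_iters_worst_case: "T \<le> k ^ n"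
proof -
  define h where "h t = restrict (assign_at n k x c0 t) {..<n}" for t
  have "inj_on h {..<T}"
  proof (rule linorder_inj_onI)
    fix s t assume st: "s < t" "s \<in> {..<T}" "t \<in> {..<T}"
    have "V t < V s" using V_diff[of s t] st by simp
    show "h s \<noteq> h t"
    proof
      assume eq: "h s = h t"
      have e: "assign_at n k x c0 s j = assign_at n k x c0 t j" if "j < n" for j
        using fun_cong[OF eq, of j] that by (simp add: h_def)
      have "cost n x (assign_at n k x c0 s) = cost n x (assign_at n k x c0 t)"
        unfolding cost_def using e fiber_cong[of n "assign_at n k x c0 s" "assign_at n k x c0 t"]
        by (intro sum.cong) auto
      moreover have "weight k (assign_at n k x c0 s) {..<n} = weight k (assign_at n k x c0 t) {..<n}"
        unfolding weight_def using e by (intro sum.cong image_cong) auto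
      ultimately have "V s = V t" by (simp add: V_def potential_def)
      with \<open>V t < V s\<close> show False by simp
    qed
  qed auto
  moreover have "h ` {..<T} \<subseteq> {..<n} \<rightarrow>\<^sub>E {..<k}"
    using k by (auto simp: h_def assign_at_def assignment_def closest_less intro!: restrict_PiE_iff[THEN iffD2])
  ultimately have "card {..<T} \<le> card ({..<n} \<rightarrow>\<^sub>E {..<k})"
    by (intro card_inj_on_le) (auto intro: finite_PiE)
  thus ?thesis by (simp add: card_PiE)
qed

end

subsection \<open>Gaussian estimates\<close>

abbreviation gauss :: "real \<Rightarrow> real \<Rightarrow> real measure" where
  "gauss m \<sigma> \<equiv> density lborel (normal_density m \<sigma>)"

section \<open>Measurability of the number of iterations\<close>

lemma pred_eq_borel:
  fixes f g :: "'a \<Rightarrow> real"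
  assumes [measurable]: "f \<in> borel_measurable M" "g \<in> borel_measurable M"
  shows "Measurable.pred M (\<lambda>x. f x = g x)"
  by measurable

lemma measurable_closest:
  assumes [measurable]: "\<And>i. (\<lambda>x. c x i) \<in> borel_measurable M" "y \<in> borel_measurable M"
  shows "(\<lambda>x. closest k (c x) (y x)) \<in> measurable M (count_space UNIV)"
  unfolding closest_def by measurable

lemma measurable_perturbed_component:
  "j < n \<Longrightarrow> (\<lambda>x. x j) \<in> borel_measurable (perturbed n \<mu> \<sigma>)"
  unfolding perturbed_def
  using measurable_component_singleton[of j "{..<n}" "\<lambda>i. gauss (\<mu> i) \<sigma>"]
  by (simp add: measurable_def)

text \<open>The cluster, a set depending on the points, is replaced by case distinctions inside sums
  over a fixed index set, a form whose measurability in \<open>x\<close> is immediate.\<close>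

lemma kmeans_step_alt:
  "kmeans_step n k x c i =
     (if \<exists>j\<in>{..<n}. closest k c (x j) = i
      then (\<Sum>j<n. if closest k c (x j) = i then x j else 0) / (\<Sum>j<n. if closest k c (x j) = i then 1 else 0)
      else c i)"
proof -
  have "cluster n k x c i = {j\<in>{..<n}. closest k c (x j) = i}" by (auto simp: cluster_def)
  thus ?thesis unfolding kmeans_step_def
    by (auto simp: sum.If_cases Int_def intro!: arg_cong2[where f = "(/)"])
qed

lemma measurable_centers:
  "(\<lambda>x. centers n k x c0 t i) \<in> borel_measurable (perturbed n \<mu> \<sigma>)"
proof (induction t arbitrary: i)
  case 0
  show ?case by (simp add: centers_def)
next
  case (Suc t)
  note [measurable] = Suc measurable_perturbed_component
  have [measurable]: "(\<lambda>x. closest k (centers n k x c0 t) (x j)) \<in> measurable (perturbed n \<mu> \<sigma>) (count_space UNIV)"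
    if "j < n" for j
    using that by (intro measurable_closest) measurable
  \<comment> \<open>This lets \<open>measurable\<close> discharge the side condition
    \<open>j < n\<close> under sums and quantifiers over \<open>{..<n}\<close>.\<close>
  have "j \<in> {..<n} \<Longrightarrow> j < n" for j by simp
  note [measurable (raw)] = this
  show ?case unfolding centers_Suc kmeans_step_alt by measurable
qed

lemma measurable_kmeans_iters:
  "(\<lambda>x. kmeans_iters n k x c0) \<in> measurable (perturbed n \<mu> \<sigma>) (count_space UNIV)"
proof -
  note [measurable] = measurable_centers measurable_perturbed_component
  have [measurable]: "(\<lambda>x. closest k (centers n k x c0 t) (x j)) \<in> measurable (perturbed n \<mu> \<sigma>) (count_space UNIV)"
    if "j < n" for j t
    using that by (intro measurable_closest) measurable
  have cl: "(\<forall>i. cluster n k x c i = cluster n k x d i) \<longleftrightarrow>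
      (\<forall>j\<in>{..<n}. closest k c (x j) = closest k d (x j))" for x c d
    by (auto simp: cluster_def set_eq_iff)
  have [measurable]: "Measurable.pred (perturbed n \<mu> \<sigma>)
      (\<lambda>x. \<forall>j\<in>{..<n}. closest k (centers n k x c0 s) (x j) = closest k (centers n k x c0 t) (x j))" for s t
    by (intro pred_intros_finite) (auto, measurable)
  have [measurable]: "Measurable.pred (perturbed n \<mu> \<sigma>) (\<lambda>x. \<forall>i. centers n k x c0 s i = centers n k x c0 t i)" for s t
    by (intro pred_intros_countable pred_eq_borel measurable_centers)
  have [measurable]: "Measurable.pred (perturbed n \<mu> \<sigma>) (\<lambda>x. kmeans_stops n k x c0 t)" for t
    unfolding kmeans_stops_def cl fun_eq_iff
    by (intro pred_intros_logic) simp_all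
  show ?thesis unfolding kmeans_iters_def by measurable
qed

text \<open>The density is at most \<open>1 / (2 * \<sigma>)\<close> because 2 pi is at least 4, and
  the interval has length \<open>2 * L\<close>.\<close>

lemma emeasure_gauss_interval:
  assumes "0 < \<sigma>" "0 \<le> L"
  shows "emeasure (gauss m \<sigma>) {a - L..a + L} \<le> ennreal (L / \<sigma>)"
proof -
  have "normal_density m \<sigma> x \<le> 1 / (2 * \<sigma>)" for x
  proof -
    have "(2 * \<sigma>)\<^sup>2 \<le> 2 * pi * \<sigma>\<^sup>2" using pi_ge_two by (simp add: power_mult_distrib mult_right_mono)
    hence "2 * \<sigma> \<le> sqrt (2 * pi * \<sigma>\<^sup>2)" by (rule real_le_rsqrt)
    hence "1 / sqrt (2 * pi * \<sigma>\<^sup>2) \<le> 1 / (2 * \<sigma>)" using assms by (intro divide_left_mono) auto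
    moreover have "exp (- (x - m)\<^sup>2 / (2 * \<sigma>\<^sup>2)) \<le> 1" by simp
    ultimately have "normal_density m \<sigma> x \<le> 1 / (2 * \<sigma>) * 1"
      unfolding normal_density_def using assms by (intro mult_mono) auto
    thus ?thesis by simp
  qed
  hence "emeasure (gauss m \<sigma>) {a - L..a + L} \<le> (\<integral>\<^sup>+x. ennreal (1 / (2 * \<sigma>)) * indicator {a - L..a + L} x \<partial>lborel)"
    by (subst emeasure_density) (auto intro!: nn_integral_mono mult_right_mono ennreal_leI)
  also have "\<dots> = ennreal (1 / (2 * \<sigma>)) * ennreal (2 * L)"
    using assms by (subst nn_integral_cmult_indicator) auto
  also have "\<dots> = ennreal (L / \<sigma>)" using assms by (subst ennreal_mult[symmetric]) auto
  finally show ?thesis .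
qed

text \<open>Exponential tilting: multiplying the density by \<open>exp ((x - m) / \<sigma>)\<close> shifts its mean by \<open>\<sigma>\<close>.\<close>

lemma emeasure_gauss_tail:
  assumes "0 < \<sigma>"
  shows "emeasure (gauss m \<sigma>) {x. \<sigma> * h < \<bar>x - m\<bar>} \<le> ennreal (2 * exp (1 / 2 - h))"
proof -
  have tilt: "exp (s * (x - m) / \<sigma>) * normal_density m \<sigma> x = exp (1 / 2) * normal_density (m + s * \<sigma>) \<sigma> x"
    if "s = 1 \<or> s = -1" for s x
  proof -
    have "s * (x - m) / \<sigma> + - (x - m)\<^sup>2 / (2 * \<sigma>\<^sup>2) = 1 / 2 + - (x - (m + s * \<sigma>))\<^sup>2 / (2 * \<sigma>\<^sup>2)"
      using assms that by (auto simp: field_simps power2_eq_square)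
    thus ?thesis unfolding normal_density_def
      by (simp add: mult.left_commute flip: exp_add)
  qed
  have le: "normal_density m \<sigma> x \<le> exp (1 / 2 - h) * (normal_density (m + \<sigma>) \<sigma> x + normal_density (m - \<sigma>) \<sigma> x)"
    if "\<sigma> * h < \<bar>x - m\<bar>" for x
  proof -
    \<comment> \<open>The sign \<open>s\<close> selects the direction of the tilt; on the tail the
      factor \<open>exp (s * (x - m) / \<sigma> - h)\<close> is at least one. Both shifted densities
      are kept in the bound, whence the constant 2.\<close>
    define s :: real where "s = (if x \<ge> m then 1 else -1)"
    have s: "s = 1 \<or> s = -1" by (auto simp: s_def)
    have "h \<le> s * (x - m) / \<sigma>" using that assms by (auto simp: s_def field_simps)
    hence "1 * normal_density m \<sigma> x \<le> exp (s * (x - m) / \<sigma> - h) * normal_density m \<sigma> x"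
      by (intro mult_right_mono) auto
    also have "\<dots> = exp (- h) * (exp (s * (x - m) / \<sigma>) * normal_density m \<sigma> x)"
      by (simp add: exp_diff exp_minus field_simps)
    also have "\<dots> = exp (1 / 2 - h) * normal_density (m + s * \<sigma>) \<sigma> x"
      unfolding tilt[OF s] by (simp add: mult_exp_exp flip: mult.assoc)
    also have "\<dots> \<le> exp (1 / 2 - h) * (normal_density (m + \<sigma>) \<sigma> x + normal_density (m - \<sigma>) \<sigma> x)"
      using s by (intro mult_left_mono) auto
    finally show ?thesis by simp
  qed
  have one: "(\<integral>\<^sup>+x. ennreal (normal_density a \<sigma> x) \<partial>lborel) = 1" for a
    using prob_space.emeasure_space_1[OF prob_space_normal_density[OF assms, of a]]
    by (simp add: emeasure_density)
  have "emeasure (gauss m \<sigma>) {x. \<sigma> * h < \<bar>x - m\<bar>}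
      \<le> (\<integral>\<^sup>+x. ennreal (exp (1 / 2 - h)) * (ennreal (normal_density (m + \<sigma>) \<sigma> x) + ennreal (normal_density (m - \<sigma>) \<sigma> x)) \<partial>lborel)"
    using le by (subst emeasure_density)
      (auto intro!: nn_integral_mono ennreal_leI simp: indicator_def simp flip: ennreal_plus ennreal_mult)
  also have "\<dots> = ennreal (exp (1 / 2 - h)) * (1 + 1)"
    by (subst nn_integral_cmult) (auto simp: nn_integral_add one)
  also have "\<dots> = ennreal (2 * exp (1 / 2 - h))"
    by (simp add: ennreal_mult mult.commute)
  finally show ?thesis .
qed

section \<open>Rare events under the product measure\<close>

context
  fixes n :: nat and \<mu> :: "nat \<Rightarrow> real" and \<sigma> :: real
  assumes \<sigma>: "0 < \<sigma>"
begin

interpretation P: product_prob_space "\<lambda>i. gauss (\<mu> i) \<sigma>" "{..<n}"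
  by (intro product_prob_spaceI prob_space_normal_density \<sigma>)

lemma prob_space_perturbed: "prob_space (perturbed n \<mu> \<sigma>)"
  unfolding perturbed_def by (intro prob_space_PiM prob_space_normal_density \<sigma>)

text \<open>By Fubini, coordinate \<open>l\<close> is integrated first: with the others fixed,
  \<open>x l\<close> must fall into an interval of radius \<open>L\<close> around
  \<open>x i\<close>. The factor \<open>f\<close>, constant in coordinate \<open>l\<close>, allows
  the estimate to be iterated.\<close>

lemma integrate_out_close:
  assumes il: "i < n" "l < n" "i \<noteq> l" and L: "0 \<le> L"
    and f[measurable]: "f \<in> borel_measurable (perturbed n \<mu> \<sigma>)"
    and indep: "\<And>x y. f (x(l := y)) = f x"
  shows "(\<integral>\<^sup>+x. f x * indicator {x. \<bar>x l - x i\<bar> \<le> L} x \<partial>perturbed n \<mu> \<sigma>)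
           \<le> ennreal (L / \<sigma>) * (\<integral>\<^sup>+x. f x \<partial>perturbed n \<mu> \<sigma>)"
proof -
  let ?M = "\<lambda>i. gauss (\<mu> i) \<sigma>"
  let ?I = "{..<n} - {l}"
  have ins: "insert l ?I = {..<n}" using il by auto
  have M: "perturbed n \<mu> \<sigma> = PiM (insert l ?I) ?M" unfolding perturbed_def ins ..
  have [measurable]: "(\<lambda>x. x i) \<in> borel_measurable (PiM (insert l ?I) ?M)"
    "(\<lambda>x. x l) \<in> borel_measurable (PiM (insert l ?I) ?M)"
    using il measurable_perturbed_component[of _ n \<mu> \<sigma>] unfolding M by auto
  have fm[measurable]: "f \<in> borel_measurable (PiM (insert l ?I) ?M)" using f unfolding M .
  have g: "(\<lambda>x. f x * indicator {x. \<bar>x l - x i\<bar> \<le> L} x) \<in> borel_measurable (PiM (insert l ?I) ?M)"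
    unfolding indicator_def mem_Collect_eq by measurable
  \<comment> \<open>Fixing coordinate \<open>l\<close> at an arbitrary value makes \<open>f\<close>
    measurable on the product of the remaining coordinates.\<close>
  have "(\<lambda>x. f (x(l := 0))) \<in> borel_measurable (PiM ?I ?M)"
    by (rule measurable_compose[OF _ fm]) (intro measurable_fun_upd[where J = ?I], auto)
  hence fI[measurable]: "f \<in> borel_measurable (PiM ?I ?M)" by (simp add: indep)
  have "(\<integral>\<^sup>+x. f x * indicator {x. \<bar>x l - x i\<bar> \<le> L} x \<partial>perturbed n \<mu> \<sigma>)
      = (\<integral>\<^sup>+x. (\<integral>\<^sup>+y. f x * indicator {x i - L..x i + L} y \<partial>?M l) \<partial>PiM ?I ?M)"
    unfolding M using il
    by (subst P.product_nn_integral_insert[OF _ _ g])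
      (auto simp: indep indicator_def intro!: nn_integral_cong)
  also have "\<dots> \<le> (\<integral>\<^sup>+x. ennreal (L / \<sigma>) * f x \<partial>PiM ?I ?M)"
  proof (intro nn_integral_mono)
    fix x
    have "(\<integral>\<^sup>+y. f x * indicator {x i - L..x i + L} y \<partial>?M l) = f x * emeasure (?M l) {x i - L..x i + L}"
      by (rule nn_integral_cmult_indicator) simp
    also have "\<dots> \<le> f x * ennreal (L / \<sigma>)"
      by (intro mult_left_mono emeasure_gauss_interval \<sigma> L) simp
    finally show "(\<integral>\<^sup>+y. f x * indicator {x i - L..x i + L} y \<partial>?M l) \<le> ennreal (L / \<sigma>) * f x"
      by (simp add: mult.commute)
  qed
  also have "\<dots> = ennreal (L / \<sigma>) * (\<integral>\<^sup>+x. f x \<partial>PiM ?I ?M)" by (rule nn_integral_cmult) measurable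
  also have "(\<integral>\<^sup>+x. f x \<partial>PiM ?I ?M) = (\<integral>\<^sup>+x. f x \<partial>perturbed n \<mu> \<sigma>)"
    unfolding M
    by (subst P.product_nn_integral_insert[OF _ _ fm])
      (auto simp: indep prob_space.emeasure_space_1[OF prob_space_normal_density[OF \<sigma>], simplified])
  finally show ?thesis .
qed

lemma emeasure_close_pairs:
  assumes "i < n" "j < n" "l < n" "i \<noteq> j" "i \<noteq> l" "j \<noteq> l" and L: "0 \<le> L"
  shows "emeasure (perturbed n \<mu> \<sigma>) {x \<in> space (perturbed n \<mu> \<sigma>). \<bar>x j - x i\<bar> \<le> L \<and> \<bar>x l - x i\<bar> \<le> L}
           \<le> ennreal ((L / \<sigma>)\<^sup>2)"
proof -
  let ?M = "perturbed n \<mu> \<sigma>"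
  note [measurable] = measurable_perturbed_component[OF assms(1), of \<mu> \<sigma>]
    measurable_perturbed_component[OF assms(2), of \<mu> \<sigma>] measurable_perturbed_component[OF assms(3), of \<mu> \<sigma>]
  let ?f = "\<lambda>x. indicator {x. \<bar>x j - x i\<bar> \<le> L} x :: ennreal"
  have ind: "indicator {x. \<bar>x j - x i\<bar> \<le> L} x = (if \<bar>x j - x i\<bar> \<le> L then 1 else 0 :: ennreal)" for x
    by (simp add: indicator_def)
  have [measurable]: "?f \<in> borel_measurable ?M" unfolding ind by measurable
  have "emeasure ?M {x \<in> space ?M. \<bar>x j - x i\<bar> \<le> L \<and> \<bar>x l - x i\<bar> \<le> L}
      = (\<integral>\<^sup>+x. indicator {x \<in> space ?M. \<bar>x j - x i\<bar> \<le> L \<and> \<bar>x l - x i\<bar> \<le> L} x \<partial>?M)"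
    by (rule nn_integral_indicator[symmetric]) measurable
  also have "\<dots> = (\<integral>\<^sup>+x. ?f x * indicator {x. \<bar>x l - x i\<bar> \<le> L} x \<partial>?M)"
    by (intro nn_integral_cong) (auto simp: indicator_def)
  \<comment> \<open>First coordinate \<open>l\<close> is integrated out, then coordinate
    \<open>j\<close> with the constant factor 1.\<close>
  also have "\<dots> \<le> ennreal (L / \<sigma>) * (\<integral>\<^sup>+x. ?f x \<partial>?M)"
    using assms by (intro integrate_out_close) (auto simp: indicator_def)
  also have "(\<integral>\<^sup>+x. ?f x \<partial>?M) = (\<integral>\<^sup>+x. 1 * ?f x \<partial>?M)" by simp
  also have "\<dots> \<le> ennreal (L / \<sigma>) * (\<integral>\<^sup>+x. 1 \<partial>?M)"
    using assms by (intro integrate_out_close) auto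
  also have "(\<integral>\<^sup>+x. 1 \<partial>?M) = 1"
    using prob_space.emeasure_space_1[OF prob_space_perturbed] by simp
  finally show ?thesis using L \<sigma> by (simp add: mult_left_mono power2_eq_square flip: ennreal_mult)
qed

lemma emeasure_close_triple:
  assumes L: "0 \<le> L"
  shows "{x \<in> space (perturbed n \<mu> \<sigma>). \<not> no_close_triple n x L} \<in> sets (perturbed n \<mu> \<sigma>)" (is "?S \<in> _")
    and "emeasure (perturbed n \<mu> \<sigma>) {x \<in> space (perturbed n \<mu> \<sigma>). \<not> no_close_triple n x L}
           \<le> ennreal (real n ^ 3 * (L / \<sigma>)\<^sup>2)"
proof -
  let ?M = "perturbed n \<mu> \<sigma>"
  let ?T = "{(i, j, l). i < n \<and> j < n \<and> l < n \<and> i \<noteq> j \<and> i \<noteq> l \<and> j \<noteq> l}"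
  let ?A = "\<lambda>(i, j, l). {x \<in> space ?M. \<bar>x j - x i\<bar> \<le> L \<and> \<bar>x l - x i\<bar> \<le> L}"
  have sub: "?T \<subseteq> {..<n} \<times> {..<n} \<times> {..<n}" by auto
  have fin: "finite ?T" by (rule finite_subset[OF sub]) auto
  have S: "?S = (\<Union>t\<in>?T. ?A t)" 
  proof (intro equalityI subsetI)
    fix x assume "x \<in> ?S"
    then obtain i j l where "x \<in> space ?M" "i < n" "j < n" "l < n" "i \<noteq> j \<and> i \<noteq> l \<and> j \<noteq> l"
      "\<bar>x j - x i\<bar> \<le> L" "\<bar>x l - x i\<bar> \<le> L" unfolding no_close_triple_def by auto
    thus "x \<in> (\<Union>t\<in>?T. ?A t)" by (intro UN_I[of "(i, j, l)"]) auto
  next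
    fix x assume "x \<in> (\<Union>t\<in>?T. ?A t)"
    then obtain t where t: "t \<in> ?T" "x \<in> ?A t" by (elim UN_E)
    obtain i j l where "t = (i, j, l)" by (cases t)
    thus "x \<in> ?S" using t by (auto simp: no_close_triple_def)
  qed
  have A: "?A t \<in> sets ?M" if tT: "t \<in> ?T" for t
  proof -
    obtain i j l where t: "t = (i, j, l)" "i < n" "j < n" "l < n" using tT by (cases t) auto
    note [measurable] = measurable_perturbed_component[OF t(2), of \<mu> \<sigma>]
      measurable_perturbed_component[OF t(3), of \<mu> \<sigma>] measurable_perturbed_component[OF t(4), of \<mu> \<sigma>]
    show ?thesis unfolding t(1) prod.case by measurable
  qed
  show "?S \<in> sets ?M" unfolding S using A fin by (intro sets.finite_UN) auto
  have "emeasure ?M ?S \<le> (\<Sum>t\<in>?T. emeasure ?M (?A t))"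
    unfolding S by (rule emeasure_subadditive_finite) (use A fin in auto)
  also have "\<dots> \<le> (\<Sum>t\<in>?T. ennreal ((L / \<sigma>)\<^sup>2))"
    by (intro sum_mono) (auto intro!: emeasure_close_pairs L)
  also have "\<dots> = of_nat (card ?T) * ennreal ((L / \<sigma>)\<^sup>2)" by simp
  also have "\<dots> \<le> of_nat (n ^ 3) * ennreal ((L / \<sigma>)\<^sup>2)"
  proof (intro mult_right_mono)
    have "card ?T \<le> card ({..<n} \<times> {..<n} \<times> {..<n})" by (rule card_mono[OF _ sub]) auto
    hence "card ?T \<le> n ^ 3" by (simp add: power3_eq_cube)
    thus "(of_nat (card ?T) :: ennreal) \<le> of_nat (n ^ 3)" by (rule of_nat_mono)
  qed simp
  also have "\<dots> = ennreal (real n ^ 3 * (L / \<sigma>)\<^sup>2)"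
    by (simp add: ennreal_of_nat_eq_real_of_nat ennreal_mult)
  finally show "emeasure ?M ?S \<le> ennreal (real n ^ 3 * (L / \<sigma>)\<^sup>2)" .
qed

lemma emeasure_far:
  shows "{x \<in> space (perturbed n \<mu> \<sigma>). \<exists>i<n. \<sigma> * h < \<bar>x i - \<mu> i\<bar>} \<in> sets (perturbed n \<mu> \<sigma>)" (is "?S \<in> _")
    and "emeasure (perturbed n \<mu> \<sigma>) {x \<in> space (perturbed n \<mu> \<sigma>). \<exists>i<n. \<sigma> * h < \<bar>x i - \<mu> i\<bar>}
           \<le> ennreal (real n * (2 * exp (1 / 2 - h)))"
proof -
  let ?M = "perturbed n \<mu> \<sigma>"
  let ?A = "\<lambda>i. {x \<in> space ?M. x i \<in> {y. \<sigma> * h < \<bar>y - \<mu> i\<bar>}}"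
  have S: "?S = (\<Union>i\<in>{..<n}. ?A i)" by auto
  have B: "{y. \<sigma> * h < \<bar>y - \<mu> i\<bar>} \<in> sets borel" for i by measurable
  have A: "?A i \<in> sets ?M" if "i < n" for i
    using measurable_sets[OF measurable_perturbed_component[OF that, of \<mu> \<sigma>] B[of i]]
    by (simp add: vimage_def Int_def conj_commute)
  show "?S \<in> sets ?M" unfolding S using A by (intro sets.finite_UN) auto
  have "emeasure ?M ?S \<le> (\<Sum>i<n. emeasure ?M (?A i))"
    unfolding S by (rule emeasure_subadditive_finite) (use A in auto)
  also have "\<dots> \<le> (\<Sum>i<n. ennreal (2 * exp (1 / 2 - h)))"
  proof (intro sum_mono)
    fix i assume "i \<in> {..<n}"
    hence "emeasure ?M (?A i) = emeasure (gauss (\<mu> i) \<sigma>) {y. \<sigma> * h < \<bar>y - \<mu> i\<bar>}"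
      unfolding perturbed_def using B by (intro P.emeasure_PiM_Collect_single) auto
    also have "\<dots> \<le> ennreal (2 * exp (1 / 2 - h))" by (rule emeasure_gauss_tail[OF \<sigma>])
    finally show "emeasure ?M (?A i) \<le> ennreal (2 * exp (1 / 2 - h))" .
  qed
  also have "\<dots> = ennreal (real n * (2 * exp (1 / 2 - h)))"
    by (simp add: ennreal_of_nat_eq_real_of_nat ennreal_mult)
  finally show "emeasure ?M ?S \<le> ennreal (real n * (2 * exp (1 / 2 - h)))" .
qed

end

subsection \<open>The expected number of iterations\<close>

text \<open>There are only finitely many triples, so excluding coincidences excludes some positive
  distance as well. This supplies the \<open>L\<close> of
  \<open>kmeans_iters_worst_case\<close>.\<close>

lemma no_close_triple_pos:
  assumes "no_close_triple n x 0"
  shows "\<exists>L>0. no_close_triple n x L"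
proof -
  have "eventually (\<lambda>L. \<forall>i\<in>{..<n}. \<forall>j\<in>{..<n}. \<forall>l\<in>{..<n}. i \<noteq> j \<and> i \<noteq> l \<and> j \<noteq> l \<longrightarrow>
      \<not> (\<bar>x j - x i\<bar> \<le> L \<and> \<bar>x l - x i\<bar> \<le> L)) (at_right 0)"
  proof (intro eventually_ball_finite ballI finite_lessThan)
    fix i j l assume "i \<in> {..<n}" "j \<in> {..<n}" "l \<in> {..<n}"
    show "eventually (\<lambda>L. i \<noteq> j \<and> i \<noteq> l \<and> j \<noteq> l \<longrightarrow>
      \<not> (\<bar>x j - x i\<bar> \<le> L \<and> \<bar>x l - x i\<bar> \<le> L)) (at_right 0)"
    proof (cases "i \<noteq> j \<and> i \<noteq> l \<and> j \<noteq> l")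
      case True
      define m where "m = max \<bar>x j - x i\<bar> \<bar>x l - x i\<bar>"
      have "\<not> (\<bar>x j - x i\<bar> \<le> 0 \<and> \<bar>x l - x i\<bar> \<le> 0)"
        using assms True \<open>i \<in> {..<n}\<close> \<open>j \<in> {..<n}\<close> \<open>l \<in> {..<n}\<close>
        unfolding no_close_triple_def by blast
      hence "0 < m" by (auto simp: m_def)
      hence "eventually (\<lambda>L. L < m) (at_right 0)"
        unfolding eventually_at_right_field by blast
      thus ?thesis by eventually_elim (auto simp: m_def)
    qed auto
  qed
  then obtain b where "0 < b" and b: "\<forall>L>0. L < b \<longrightarrow> (\<forall>i\<in>{..<n}. \<forall>j\<in>{..<n}. \<forall>l\<in>{..<n}. i \<noteq> j \<and> i \<noteq> l \<and> j \<noteq> l \<longrightarrow>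
      \<not> (\<bar>x j - x i\<bar> \<le> L \<and> \<bar>x l - x i\<bar> \<le> L))"
    unfolding eventually_at_right_field by blast
  have "no_close_triple n x (b / 2)"
    unfolding no_close_triple_def using b[rule_format, of "b / 2"] \<open>0 < b\<close> by force
  thus ?thesis using \<open>0 < b\<close> by (intro exI[of _ "b / 2"]) auto
qed

text \<open>If \<open>m\<close> exceeds the last power, all powers occur and their sum is one less
  than the next power. Integrated, this bounds an expectation by tail probabilities at only
  \<open>J\<close> thresholds.\<close>

lemma dyadic_bound:
  fixes m :: nat
  assumes "m \<le> 2 ^ J"
  shows "m \<le> 1 + (\<Sum>j<J. if 2 ^ j < m then 2 ^ j else 0)"
  using assms
proof (induction J)
  case (Suc J)
  show ?case
  proof (cases "m \<le> 2 ^ J")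
    case False
    have "(\<Sum>j<Suc J. if 2 ^ j < m then 2 ^ j else 0) = (\<Sum>j<Suc J. 2 ^ j :: nat)"
    proof (intro sum.cong refl)
      fix j assume "j \<in> {..<Suc J}"
      hence "(2::nat) ^ j \<le> 2 ^ J" by (intro power_increasing) auto
      hence "2 ^ j < m" using False by linarith
      thus "(if 2 ^ j < m then 2 ^ j else 0) = (2 ^ j :: nat)" by simp
    qed
    also have "1 + \<dots> = 2 ^ Suc J" by (induction J) auto
    finally show ?thesis using Suc.prems by simp
  qed (use Suc.IH in simp)
qed simp

lemma kmeans_iters_le_exp:
  assumes "1 \<le> k" "k \<le> n" "no_close_triple n x 0"
  shows "kmeans_iters n k x c0 \<le> enat (2 ^ (n ^ 2 + 1))"
proof (rule ccontr)
  assume "\<not> ?thesis"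
  hence T: "enat (2 ^ (n ^ 2 + 1)) < kmeans_iters n k x c0" by simp
  obtain L where L: "0 < L" "no_close_triple n x L" using no_close_triple_pos[OF assms(3)] by blast
  have "2 ^ (n ^ 2 + 1) \<le> k ^ n" by (rule kmeans_iters_worst_case[OF assms(1,2) L T])
  also have "\<dots> \<le> (2 ^ n) ^ n"
  proof (rule power_mono)
    show "k \<le> 2 ^ n" using assms(2) less_exp[of n] by linarith
  qed simp
  also have "\<dots> = 2 ^ (n ^ 2)" by (simp add: power_mult[symmetric] power2_eq_square)
  finally show False by simp
qed

locale smoothed_kmeans =
  fixes n k :: nat and \<mu> c0 :: "nat \<Rightarrow> real" and \<sigma> :: real
  assumes k: "1 \<le> k" "k \<le> n" and \<sigma>: "0 < \<sigma>" and \<mu>: "\<And>i. i < n \<Longrightarrow> 0 \<le> \<mu> i \<and> \<mu> i \<le> 1"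
begin

abbreviation (input) "M \<equiv> perturbed n \<mu> \<sigma>"
abbreviation (input) "N x \<equiv> kmeans_iters n k x c0"

text \<open>In units of \<sigma>, large enough for the exponential tail to beat both the number of
  points and the worst-case number of iterations; see \<open>emeasure_Far\<close>.\<close>

definition "radius = real n ^ 2 + real n + 1"
definition "Far = {x \<in> space M. \<exists>i<n. \<sigma> * radius < \<bar>x i - \<mu> i\<bar>}"
definition "Long T = {x \<in> space M - Far. enat T < N x}"

lemma n_ge_1: "1 \<le> real n"
  using k by simp

lemma Far_sets [measurable]: "Far \<in> sets M"
  unfolding Far_def by (rule emeasure_far(1)[OF \<sigma>])

lemma Long_sets [measurable]: "Long T \<in> sets M"
proof -
  have "{x \<in> space M. N x \<in> {N. enat T < N}} \<in> sets M"
    using measurable_kmeans_iters[of n k c0 \<mu> \<sigma>] by measurable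
  hence "{x \<in> space M. N x \<in> {N. enat T < N}} - Far \<in> sets M" by (intro sets.Diff Far_sets)
  also have "{x \<in> space M. N x \<in> {N. enat T < N}} - Far = Long T" by (auto simp: Long_def)
  finally show ?thesis .
qed

lemma emeasure_Far: "2 ^ (n ^ 2 + 1) * emeasure M Far \<le> 4"
proof -
  have "2 ^ (n ^ 2) \<le> exp (real n ^ 2)"
  proof -
    have "2 ^ (n ^ 2) \<le> exp (1 :: real) ^ (n ^ 2)" using exp_ge_add_one_self[of 1] by (intro power_mono) auto
    thus ?thesis by (simp flip: exp_of_nat_mult)
  qed
  moreover have "real n \<le> exp (real n)" using exp_ge_add_one_self[of "real n"] by linarith
  ultimately have "2 ^ (n ^ 2) * real n * exp (1 / 2 - radius) \<le> exp (real n ^ 2) * exp (real n) * exp (1 / 2 - radius)"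
    by (intro mult_right_mono mult_mono) auto
  also have "\<dots> \<le> 1" by (simp add: radius_def flip: exp_add)
  finally have le: "2 ^ (n ^ 2) * real n * exp (1 / 2 - radius) \<le> 1" .
  have "2 ^ (n ^ 2 + 1) = ennreal (2 ^ (n ^ 2 + 1))"
    by (metis ennreal_numeral ennreal_power zero_le_numeral)
  hence "2 ^ (n ^ 2 + 1) * emeasure M Far \<le> ennreal (2 ^ (n ^ 2 + 1)) * ennreal (real n * (2 * exp (1 / 2 - radius)))"
    unfolding Far_def using emeasure_far(2)[OF \<sigma>, of n \<mu> radius] by (simp add: mult_left_mono)
  also have "\<dots> = ennreal (4 * (2 ^ (n ^ 2) * real n * exp (1 / 2 - radius)))"
    by (simp add: ennreal_mult[symmetric] mult_ac del: ennreal_power)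
  also have "\<dots> \<le> ennreal 4" using le by (intro ennreal_leI) auto
  finally show ?thesis by simp
qed

lemma emeasure_Long:
  assumes T: "0 < T"
  shows "of_nat T * emeasure M (Long T) \<le> ennreal (62214 * real n ^ 16 + 1728 * real n ^ 12 * (1 / \<sigma>)\<^sup>2)"
    (is "_ \<le> ennreal ?K")
proof (cases "real T \<le> 6 * real n ^ 2")
  case True
  have "of_nat T * emeasure M (Long T) \<le> of_nat T * 1"
    using prob_space.emeasure_le_1[OF prob_space_perturbed[OF \<sigma>]] by (intro mult_left_mono) auto
  also have "\<dots> = ennreal (real T)" by (simp add: ennreal_of_nat_eq_real_of_nat)
  also have "\<dots> \<le> ennreal ?K"
  proof (rule ennreal_leI)
    have "real n ^ 2 \<le> real n ^ 16" using n_ge_1 by (intro power_increasing) auto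
    moreover have "0 \<le> real n ^ 16" "0 \<le> 1728 * real n ^ 12 * (1 / \<sigma>)\<^sup>2" by auto
    ultimately show "real T \<le> ?K" using True by linarith
  qed
  finally show ?thesis .
next
  case False
  define D where "D = 1 + 2 * (\<sigma> * radius)"
  \<comment> \<open>With this \<open>L\<close> the second summand of
    \<open>kmeans_iters_poly_bound\<close> equals \<open>T / 2\<close>, so a run without a close
    triple would satisfy \<open>T \<le> 6 * real n ^ 2\<close>. As \<open>L\<^sup>2\<close> is
    proportional to \<open>1 / T\<close>, multiplying the probability of a close triple by
    \<open>T\<close> removes \<open>T\<close> from the bound.\<close>
  define L where "L = sqrt (864 * real n ^ 9 * D\<^sup>2 / real T)"
  have rad: "0 \<le> radius" by (simp add: radius_def)
  have D: "0 < D" using \<sigma> rad by (simp add: D_def add_pos_nonneg)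
  have Lpos: "0 < 864 * real n ^ 9 * D\<^sup>2 / real T" using D T n_ge_1 by auto
  hence L: "0 < L" and L2: "L\<^sup>2 = 864 * real n ^ 9 * D\<^sup>2 / real T" by (auto simp: L_def)
  have "Long T \<subseteq> {x \<in> space M. \<not> no_close_triple n x L}"
  proof
    fix x assume x: "x \<in> Long T"
    have "\<not> no_close_triple n x L"
    proof
      assume tr: "no_close_triple n x L"
      have near: "\<bar>x i - \<mu> i\<bar> \<le> \<sigma> * radius" if "i < n" for i
        by (rule ccontr) (use x that in \<open>auto simp: Long_def Far_def\<close>)
      have diam: "\<bar>x i - x j\<bar> \<le> D" if "i < n" "j < n" for i j
        using near[OF that(1)] near[OF that(2)] \<mu>[OF that(1)] \<mu>[OF that(2)] unfolding D_def by linarith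
      have "enat T < N x" using x by (simp add: Long_def)
      from kmeans_iters_poly_bound[OF k L tr this diam]
      have "real T \<le> 3 * real n ^ 2 + 432 * real n ^ 9 * D\<^sup>2 / L\<^sup>2" by simp
      also have "432 * real n ^ 9 * D\<^sup>2 / L\<^sup>2 = real T / 2" unfolding L2 using D T n_ge_1 by simp
      finally show False using False by simp
    qed
    thus "x \<in> {x \<in> space M. \<not> no_close_triple n x L}" using x by (simp add: Long_def)
  qed
  hence "emeasure M (Long T) \<le> emeasure M {x \<in> space M. \<not> no_close_triple n x L}"
    using L by (intro emeasure_mono emeasure_close_triple(1)[OF \<sigma>]) auto
  also have "\<dots> \<le> ennreal (real n ^ 3 * (L / \<sigma>)\<^sup>2)" using L by (intro emeasure_close_triple(2)[OF \<sigma>]) auto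
  finally have "of_nat T * emeasure M (Long T) \<le> ennreal (real T) * ennreal (real n ^ 3 * (L / \<sigma>)\<^sup>2)"
    by (intro mult_mono) (auto simp: ennreal_of_nat_eq_real_of_nat)
  also have "\<dots> = ennreal (real T * (real n ^ 3 * (L / \<sigma>)\<^sup>2))" by (simp add: ennreal_mult)
  also have "real T * (real n ^ 3 * (L / \<sigma>)\<^sup>2) = 864 * real n ^ 12 * (D / \<sigma>)\<^sup>2"
  proof -
    have "real T * (real n ^ 3 * (L / \<sigma>)\<^sup>2) = 864 * (real n ^ 3 * real n ^ 9) * (D / \<sigma>)\<^sup>2"
      unfolding power_divide L2 using T by (simp add: field_simps)
    also have "real n ^ 3 * real n ^ 9 = real n ^ 12" by (simp flip: power_add)
    finally show ?thesis .
  qed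
  also have "ennreal (864 * real n ^ 12 * (D / \<sigma>)\<^sup>2) \<le> ennreal ?K"
  proof (rule ennreal_leI)
    have "D / \<sigma> = 1 / \<sigma> + 2 * radius" using \<sigma> by (simp add: D_def field_simps)
    also have "(\<dots>)\<^sup>2 \<le> 2 * (1 / \<sigma>)\<^sup>2 + 2 * (2 * radius)\<^sup>2"
      using zero_le_power2[of "1 / \<sigma> - 2 * radius"] by (simp only: power2_sum power2_diff)
    also have "(2 * radius)\<^sup>2 \<le> (6 * real n ^ 2)\<^sup>2"
    proof (intro power_mono)
      have "real n \<le> real n ^ 2" "1 \<le> real n ^ 2"
        using n_ge_1 power_increasing[of 1 2 "real n"] one_le_power[of "real n" 2] by simp_all
      hence "radius \<le> 3 * real n ^ 2" unfolding radius_def by linarith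
      thus "2 * radius \<le> 6 * real n ^ 2" by simp
    qed (use rad in simp)
    finally have "(D / \<sigma>)\<^sup>2 \<le> 2 * (1 / \<sigma>)\<^sup>2 + 72 * real n ^ 4"
      by (simp add: power_mult_distrib power_mult[symmetric])
    hence "864 * real n ^ 12 * (D / \<sigma>)\<^sup>2 \<le> 864 * real n ^ 12 * (2 * (1 / \<sigma>)\<^sup>2 + 72 * real n ^ 4)"
      by (intro mult_left_mono) auto
    also have "\<dots> = 62208 * (real n ^ 12 * real n ^ 4) + 1728 * real n ^ 12 * (1 / \<sigma>)\<^sup>2"
      by (simp add: algebra_simps)
    also have "real n ^ 12 * real n ^ 4 = real n ^ 16" by (simp flip: power_add)
    also have "62208 * real n ^ 16 + 1728 * real n ^ 12 * (1 / \<sigma>)\<^sup>2 \<le> ?K" by simp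
    finally show "864 * real n ^ 12 * (D / \<sigma>)\<^sup>2 \<le> ?K" .
  qed
  finally show ?thesis .
qed

text \<open>Almost surely no three points coincide, so the exponential bound holds. It is charged in
  full on \<open>Far\<close>; elsewhere \<open>dyadic_bound\<close> distributes the count over the
  events \<open>Long (2 ^ j)\<close>.\<close>

lemma AE_kmeans_iters_le:
  "AE x in M. ennreal_of_enat (N x)
     \<le> 2 ^ (n ^ 2 + 1) * indicator Far x + (1 + (\<Sum>j<n ^ 2 + 1. 2 ^ j * indicator (Long (2 ^ j)) x))"
proof -
  have "emeasure M {x \<in> space M. \<not> no_close_triple n x 0} = 0"
    using emeasure_close_triple(2)[OF \<sigma>, of 0 n \<mu>] by simp
  hence "AE x in M. no_close_triple n x 0"
    using emeasure_close_triple(1)[OF \<sigma>, of 0 n \<mu>] by (intro AE_I[of _ _ "{x \<in> space M. \<not> no_close_triple n x 0}"]) auto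
  moreover have "AE x in M. x \<in> space M" by simp
  ultimately show ?thesis
  proof eventually_elim
    case (elim x)
    have "N x \<le> enat (2 ^ (n ^ 2 + 1))" by (rule kmeans_iters_le_exp[OF k elim(1)])
    then obtain m where m: "N x = enat m" "m \<le> 2 ^ (n ^ 2 + 1)" by (cases "N x") auto
    show ?case
    proof (cases "x \<in> Far")
      case True
      have "ennreal_of_enat (N x) = of_nat m" using m by simp
      also have "\<dots> \<le> of_nat (2 ^ (n ^ 2 + 1))" using m(2) by (rule of_nat_mono)
      finally show ?thesis using True by (simp add: add_increasing2)
    next
      case False
      have ind: "indicator (Long (2 ^ j)) x = (if 2 ^ j < m then 1 else 0 :: ennreal)" for j
        using False elim(2) m by (simp add: Long_def indicator_def)
      have "ennreal_of_enat (N x) = of_nat m" using m by simp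
      also have "\<dots> \<le> of_nat (1 + (\<Sum>j<n ^ 2 + 1. if 2 ^ j < m then 2 ^ j else 0))"
        using dyadic_bound[OF m(2)] by (rule of_nat_mono)
      also have "\<dots> = 1 + (\<Sum>j<n ^ 2 + 1. 2 ^ j * indicator (Long (2 ^ j)) x)"
        unfolding ind of_nat_add of_nat_sum by (auto intro!: sum.cong)
      finally show ?thesis using False by simp
    qed
  qed
qed

text \<open>Each of the \<open>n ^ 2 + 1\<close> dyadic terms costs at most the bound of
  \<open>emeasure_Long\<close>, so the worst-case exponent enters only as a factor of order
  \<open>n ^ 2\<close>; \<open>Far\<close> contributes at most 4.\<close>

lemma expected_kmeans_iters_le:
  "(\<integral>\<^sup>+x. ennreal_of_enat (N x) \<partial>M) \<le> ennreal (130000 * real n ^ 18 + 130000 * real n ^ 18 * (1 / \<sigma>)\<^sup>2)"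
proof -
  let ?K = "62214 * real n ^ 16 + 1728 * real n ^ 12 * (1 / \<sigma>)\<^sup>2"
  have "(\<integral>\<^sup>+x. ennreal_of_enat (N x) \<partial>M)
      \<le> (\<integral>\<^sup>+x. 2 ^ (n ^ 2 + 1) * indicator Far x + (1 + (\<Sum>j<n ^ 2 + 1. 2 ^ j * indicator (Long (2 ^ j)) x)) \<partial>M)"
    by (rule nn_integral_mono_AE[OF AE_kmeans_iters_le])
  also have "\<dots> = 2 ^ (n ^ 2 + 1) * emeasure M Far + (1 + (\<Sum>j<n ^ 2 + 1. 2 ^ j * emeasure M (Long (2 ^ j))))"
  proof -
    let ?F = "\<lambda>x. 2 ^ (n ^ 2 + 1) * indicator Far x :: ennreal"
    let ?S = "\<lambda>x. \<Sum>j<n ^ 2 + 1. 2 ^ j * indicator (Long (2 ^ j)) x :: ennreal"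
    have "(\<integral>\<^sup>+x. ?F x + (1 + ?S x) \<partial>M) = (\<integral>\<^sup>+x. ?F x \<partial>M) + (\<integral>\<^sup>+x. 1 + ?S x \<partial>M)"
      by (rule nn_integral_add) measurable
    moreover have "(\<integral>\<^sup>+x. 1 + ?S x \<partial>M) = (\<integral>\<^sup>+x. 1 \<partial>M) + (\<integral>\<^sup>+x. ?S x \<partial>M)"
      by (rule nn_integral_add) measurable
    moreover have "(\<integral>\<^sup>+x. ?S x \<partial>M) = (\<Sum>j<n ^ 2 + 1. \<integral>\<^sup>+x. 2 ^ j * indicator (Long (2 ^ j)) x \<partial>M)"
      by (rule nn_integral_sum) measurable
    moreover have "(\<integral>\<^sup>+x. 1 \<partial>M) = 1"
      using prob_space.emeasure_space_1[OF prob_space_perturbed[OF \<sigma>]] by simp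
    ultimately show ?thesis
      by (simp only: nn_integral_cmult_indicator[OF Far_sets] nn_integral_cmult_indicator[OF Long_sets])
  qed
  also have "\<dots> \<le> 4 + (1 + (\<Sum>j<n ^ 2 + 1. ennreal ?K))"
  proof (intro add_mono emeasure_Far order_refl sum_mono)
    fix j show "2 ^ j * emeasure M (Long (2 ^ j)) \<le> ennreal ?K"
      using emeasure_Long[of "2 ^ j"] by simp
  qed
  also have "\<dots> = ennreal (5 + real (n ^ 2 + 1) * ?K)"
  proof -
    have K: "0 \<le> ?K" by simp
    have "(\<Sum>j<n ^ 2 + 1. ennreal ?K) = ennreal (real (n ^ 2 + 1)) * ennreal ?K"
      unfolding sum_constant card_lessThan by (simp only: ennreal_of_nat_eq_real_of_nat)
    also have "\<dots> = ennreal (real (n ^ 2 + 1) * ?K)"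
      by (rule ennreal_mult[symmetric]) (use K in auto)
    finally have sum: "(\<Sum>j<n ^ 2 + 1. ennreal ?K) = ennreal (real (n ^ 2 + 1) * ?K)" .
    have "ennreal (5 + a) = 4 + (1 + ennreal a)" if "0 \<le> a" for a
      using that by simp
    thus ?thesis unfolding sum using K by simp
  qed
  also have "\<dots> \<le> ennreal (130000 * real n ^ 18 + 130000 * real n ^ 18 * (1 / \<sigma>)\<^sup>2)"
  proof (rule ennreal_leI)
    have n2: "1 \<le> real n ^ 2" using n_ge_1 by simp
    have "real (n ^ 2 + 1) * ?K \<le> (2 * real n ^ 2) * ?K"
      using n2 by (intro mult_right_mono add_nonneg_nonneg) auto
    also have "\<dots> = 124428 * (real n ^ 2 * real n ^ 16) + 3456 * (real n ^ 2 * real n ^ 12) * (1 / \<sigma>)\<^sup>2"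
      by (simp add: algebra_simps)
    also have "\<dots> = 124428 * real n ^ 18 + 3456 * real n ^ 14 * (1 / \<sigma>)\<^sup>2" by (simp flip: power_add)
    also have "\<dots> \<le> 124428 * real n ^ 18 + 130000 * real n ^ 18 * (1 / \<sigma>)\<^sup>2"
      using n_ge_1 power_increasing[of 14 18 "real n"]
      by (intro add_left_mono mult_right_mono mult_mono) auto
    finally have "real (n ^ 2 + 1) * ?K \<le> \<dots>" .
    moreover have "1 \<le> real n ^ 18" using n_ge_1 by simp
    ultimately show "5 + real (n ^ 2 + 1) * ?K \<le> 130000 * real n ^ 18 + 130000 * real n ^ 18 * (1 / \<sigma>)\<^sup>2" by linarith
  qed
  finally show ?thesis .
qed

end

section \<open>Polynomial bounds for the expectation and the tail\<close>

definition monomial_pair :: "nat \<Rightarrow> nat \<Rightarrow> nat \<Rightarrow> real" where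
  "monomial_pair d i j = (if i = d \<and> (j = 0 \<or> j = 2) then 130000 else 0)"

lemma poly2_monomial_pair:
  assumes "2 \<le> d"
  shows "poly2 (monomial_pair d) d u v = 130000 * u ^ d + 130000 * u ^ d * v\<^sup>2"
proof -
  have "poly2 (monomial_pair d) d u v
      = (\<Sum>i\<le>d. if i = d then \<Sum>j\<le>d. (if j = 0 \<or> j = 2 then 130000 else 0) * u ^ d * v ^ j else 0)"
    unfolding poly2_def monomial_pair_def by (intro sum.cong) auto
  also have "\<dots> = (\<Sum>j\<le>d. (if j = 0 \<or> j = 2 then 130000 else 0) * u ^ d * v ^ j)" by simp
  also have "\<dots> = (\<Sum>j\<le>d. (if j = 0 then 130000 * u ^ d else 0) + (if j = 2 then 130000 * u ^ d * v\<^sup>2 else 0))"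
    by (intro sum.cong) auto
  also have "\<dots> = 130000 * u ^ d + 130000 * u ^ d * v\<^sup>2"
    using assms by (simp add: sum.distrib)
  finally show ?thesis .
qed

theorem theorem4:
  shows "(\<exists>(a :: nat \<Rightarrow> nat \<Rightarrow> real) D.
            \<forall>(n::nat) (k::nat) (\<sigma>::real) (\<mu>::nat \<Rightarrow> real) (c0::nat \<Rightarrow> real).
              1 \<le> k \<and> k \<le> n \<and> \<sigma> > 0 \<and> (\<forall>i<n. 0 \<le> \<mu> i \<and> \<mu> i \<le> 1) \<longrightarrow>
              (\<integral>\<^sup>+ x. ennreal_of_enat (kmeans_iters n k x c0) \<partial>perturbed n \<mu> \<sigma>)
                \<le> ennreal (poly2 a D (real n) (1 / \<sigma>)))
       \<and> (\<exists>(q :: nat \<Rightarrow> nat \<Rightarrow> real) D (c::real). c > 0 \<and>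
            (\<forall>(n::nat) (k::nat) (\<sigma>::real) (\<mu>::nat \<Rightarrow> real) (c0::nat \<Rightarrow> real).
              1 \<le> k \<and> k \<le> n \<and> \<sigma> > 0 \<and> (\<forall>i<n. 0 \<le> \<mu> i \<and> \<mu> i \<le> 1) \<longrightarrow>
              (\<lambda>x. kmeans_iters n k x c0) \<in> measurable (perturbed n \<mu> \<sigma>) (count_space UNIV) \<and>
              emeasure (perturbed n \<mu> \<sigma>)
                 {x \<in> space (perturbed n \<mu> \<sigma>).
                    ereal_of_enat (kmeans_iters n k x c0) > ereal (poly2 q D (real n) (1 / \<sigma>))}
                \<le> ennreal (real n powr (- c))))"
proof (intro conjI)
  have expected: "(\<integral>\<^sup>+ x. ennreal_of_enat (kmeans_iters n k x c0) \<partial>perturbed n \<mu> \<sigma>)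
      \<le> ennreal (poly2 (monomial_pair 18) 18 (real n) (1 / \<sigma>))"
    if "1 \<le> k \<and> k \<le> n \<and> \<sigma> > 0 \<and> (\<forall>i<n. 0 \<le> \<mu> i \<and> \<mu> i \<le> 1)" for n k \<sigma> and \<mu> c0 :: "nat \<Rightarrow> real"
    using smoothed_kmeans.expected_kmeans_iters_le[of n k \<mu> \<sigma> c0] that
    by (simp add: smoothed_kmeans_def poly2_monomial_pair)
  then show "\<exists>(a :: nat \<Rightarrow> nat \<Rightarrow> real) D.
            \<forall>(n::nat) (k::nat) (\<sigma>::real) (\<mu>::nat \<Rightarrow> real) (c0::nat \<Rightarrow> real).
              1 \<le> k \<and> k \<le> n \<and> \<sigma> > 0 \<and> (\<forall>i<n. 0 \<le> \<mu> i \<and> \<mu> i \<le> 1) \<longrightarrow>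
              (\<integral>\<^sup>+ x. ennreal_of_enat (kmeans_iters n k x c0) \<partial>perturbed n \<mu> \<sigma>)
                \<le> ennreal (poly2 a D (real n) (1 / \<sigma>))"
    by blast
  have tail: "emeasure (perturbed n \<mu> \<sigma>)
                 {x \<in> space (perturbed n \<mu> \<sigma>).
                    ereal_of_enat (kmeans_iters n k x c0) > ereal (poly2 (monomial_pair 19) 19 (real n) (1 / \<sigma>))}
                \<le> ennreal (real n powr (- 1))"
    if asm: "1 \<le> k \<and> k \<le> n \<and> \<sigma> > 0 \<and> (\<forall>i<n. 0 \<le> \<mu> i \<and> \<mu> i \<le> 1)" for n k \<sigma> and \<mu> c0 :: "nat \<Rightarrow> real"
  proof -
    let ?M = "perturbed n \<mu> \<sigma>"
    let ?u = "\<lambda>x. ennreal_of_enat (kmeans_iters n k x c0)"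
    define p where "p = poly2 (monomial_pair 18) 18 (real n) (1 / \<sigma>)"
    have n: "0 < real n" using asm by simp
    have p: "0 < p" using n by (simp add: p_def poly2_monomial_pair add_pos_nonneg)
    \<comment> \<open>Markov's inequality is applied at \<open>n\<close> times the expectation
      bound, which gives probability at most \<open>1 / n\<close>, hence \<open>c = 1\<close>. The
      extra factor \<open>n\<close> raises the degree from 18 to 19.\<close>
    have q: "poly2 (monomial_pair 19) 19 (real n) (1 / \<sigma>) = real n * p"
    proof -
      have "real n ^ 19 = real n * real n ^ 18" by (simp flip: power_Suc)
      thus ?thesis by (simp add: p_def poly2_monomial_pair algebra_simps)
    qed
    have [measurable]: "?u \<in> borel_measurable ?M"
      using measurable_kmeans_iters[of n k c0 \<mu> \<sigma>] by measurable
    have "{x \<in> space ?M. ereal_of_enat (kmeans_iters n k x c0) > ereal (real n * p)}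
        \<subseteq> {x \<in> space ?M. 1 \<le> ennreal (1 / (real n * p)) * ?u x}"
    proof safe
      fix x assume gt: "ereal_of_enat (kmeans_iters n k x c0) > ereal (real n * p)"
      show "1 \<le> ennreal (1 / (real n * p)) * ?u x"
      proof (cases "kmeans_iters n k x c0")
        case (enat m)
        hence "real n * p < real m" using gt by simp
        hence "1 \<le> 1 / (real n * p) * real m" using n p by (simp add: field_simps)
        hence "ennreal 1 \<le> ennreal (1 / (real n * p) * real m)" by (rule ennreal_leI)
        also have "\<dots> = ennreal (1 / (real n * p)) * ennreal (real m)" using n p by (intro ennreal_mult) auto
        finally show ?thesis using enat by (simp add: ennreal_of_nat_eq_real_of_nat)
      next
        case infinity
        thus ?thesis using n p by (simp add: ennreal_mult_top)
      qed
    qed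
    hence "emeasure ?M {x \<in> space ?M. ereal_of_enat (kmeans_iters n k x c0) > ereal (real n * p)}
        \<le> emeasure ?M {x \<in> space ?M. 1 \<le> ennreal (1 / (real n * p)) * ?u x}"
      by (intro emeasure_mono) measurable
    also have "\<dots> \<le> ennreal (1 / (real n * p)) * (\<integral>\<^sup>+x. ?u x * indicator (space ?M) x \<partial>?M)"
      by (rule nn_integral_Markov_inequality) measurable
    also have "(\<integral>\<^sup>+x. ?u x * indicator (space ?M) x \<partial>?M) = (\<integral>\<^sup>+x. ?u x \<partial>?M)"
      by (intro nn_integral_cong) simp
    also have "ennreal (1 / (real n * p)) * \<dots> \<le> ennreal (1 / (real n * p)) * ennreal p"
      using expected[OF asm, of c0] by (intro mult_left_mono) (auto simp: p_def)
    also have "\<dots> = ennreal (real n powr (- 1))"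
      using n p by (simp add: powr_minus divide_simps flip: ennreal_mult)
    finally show ?thesis unfolding q .
  qed
  show "\<exists>(q :: nat \<Rightarrow> nat \<Rightarrow> real) D (c::real). c > 0 \<and>
            (\<forall>(n::nat) (k::nat) (\<sigma>::real) (\<mu>::nat \<Rightarrow> real) (c0::nat \<Rightarrow> real).
              1 \<le> k \<and> k \<le> n \<and> \<sigma> > 0 \<and> (\<forall>i<n. 0 \<le> \<mu> i \<and> \<mu> i \<le> 1) \<longrightarrow>
              (\<lambda>x. kmeans_iters n k x c0) \<in> measurable (perturbed n \<mu> \<sigma>) (count_space UNIV) \<and>
              emeasure (perturbed n \<mu> \<sigma>)
                 {x \<in> space (perturbed n \<mu> \<sigma>).
                    ereal_of_enat (kmeans_iters n k x c0) > ereal (poly2 q D (real n) (1 / \<sigma>))}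
                \<le> ennreal (real n powr (- c)))"
    by (intro exI[of _ "monomial_pair 19"] exI[of _ 19] exI[of _ "1 :: real"] conjI allI impI
        measurable_kmeans_iters tail) simp_all
qed

end
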